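(* Let $n\ge1$, let $R=R_{\mathcal{K}_{2n}}$, and let $F:\mathcal{K}_{2n}^*\to\mathcal{K}_{2n}$ be the Drinfeld map $F(f)=(\mathrm{id}\otimes f)(R_{21}R)$. Then $F$ is not an isomorphism. Thus $\mathcal{K}_m$ is not factorizable for any $m\geq 1$.
   Context: For $m\ge1$, the Nichols Hopf algebra $\mathcal{K}_m$ is the $2^{m+1}$-dimensional complex Hopf algebra generated by $K,\xi_1,\dots,\xi_m$ with $K^2=1$, $\xi_i^2=0$, $K\xi_i=-\xi_iK$, $\xi_i\xi_j=-\xi_j\xi_i$, and $\Delta(K)=K\otimes K$, $\Delta(\xi_i)=K\otimes\xi_i+\xi_i\otimes1$, $\epsilon(K)=1$, $\epsilon(\xi_i)=0$, $S(K)=K$, $S(\xi_i)=-K\xi_i$. Let $W$ be the set of words $w=\xi_{i_1}\cdots\xi_{i_k}$ with $1\le i_1<\dots<i_k\le n$, $k\ge0$, viewed in $\mathcal{K}_{2n}$, with $|w|=k$; for such $w$ put $\pi(\bar w)=\xi_{i_1+n}\cdots\xi_{i_k+n}\in\mathcal{K}_{2n}$. Then $R_{\mathcal{K}_{2n}}=\sum_{w\in W}(-1)^{\lfloor|w|/2\rfloor}(w\otimes\pi(\bar w)K^{|w|})\cdot\tfrac12(1\otimes1+K\otimes1+1\otimes K-K\otimes K)$ is a universal $R$-matrix for $\mathcal{K}_{2n}$. A quasitriangular Hopf algebra $(H,R)$ is factorizable if its Drinfeld map $H^*\to H$ is an isomorphism of vector spaces; a Hopf algebra is called not factorizable if it has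 no universal $R$-matrix making it factorizable. *)

theory Defs
  imports Complex_Main "HOL-Library.Poly_Mapping"
begin

section \<open>Complex vector spaces and unital complex algebras\<close>

class complex_vector = ab_group_add +
  fixes scaleC :: "complex \<Rightarrow> 'a \<Rightarrow> 'a" (infixr \<open>*\<^sub>C\<close> 75)
  assumes scaleC_add_right: "a *\<^sub>C (x + y) = a *\<^sub>C x + a *\<^sub>C y"
    and scaleC_add_left: "(a + b) *\<^sub>C x = a *\<^sub>C x + b *\<^sub>C x"
    and scaleC_scaleC: "a *\<^sub>C b *\<^sub>C x = (a * b) *\<^sub>C x"
    and scaleC_one: "1 *\<^sub>C x = x"

class complex_algebra_1 = complex_vector + ring_1 +
  assumes mult_scaleC_left: "(a *\<^sub>C x) * y = a *\<^sub>C (x * y)"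
    and mult_scaleC_right: "x * (a *\<^sub>C y) = a *\<^sub>C (x * y)"

global_interpretation complex_vector:
  vector_space "scaleC :: complex \<Rightarrow> 'a \<Rightarrow> 'a::complex_vector"
  by standard (simp_all add: scaleC_add_right scaleC_add_left scaleC_scaleC scaleC_one)

global_interpretation complex_vector:
  vector_space_pair "scaleC :: complex \<Rightarrow> 'a \<Rightarrow> 'a::complex_vector"
    "scaleC :: complex \<Rightarrow> 'b \<Rightarrow> 'b::complex_vector" ..

abbreviation clinear :: "('a::complex_vector \<Rightarrow> 'b::complex_vector) \<Rightarrow> bool"
  where "clinear \<equiv> Vector_Spaces.linear scaleC scaleC"

lemma clinear_iff:
  "clinear f \<longleftrightarrow> (\<forall>x y. f (x + y) = f x + f y) \<and> (\<forall>c x. f (c *\<^sub>C x) = c *\<^sub>C f x)"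
  unfolding Vector_Spaces.linear_def module_hom_def module_hom_axioms_def
  by (simp add: complex_vector.vector_space_axioms complex_vector.module_axioms)

definition cbilinear :: "('a::complex_vector \<Rightarrow> 'b::complex_vector \<Rightarrow> 'c::complex_vector) \<Rightarrow> bool"
  where "cbilinear B \<longleftrightarrow> (\<forall>x. clinear (B x)) \<and> (\<forall>y. clinear (\<lambda>x. B x y))"

definition vector_space_iso :: "('a::complex_vector \<Rightarrow> 'b::complex_vector) \<Rightarrow> bool"
  where "vector_space_iso f \<longleftrightarrow> clinear f \<and> bij f"

definition algebra_hom :: "('a::complex_algebra_1 \<Rightarrow> 'b::complex_algebra_1) \<Rightarrow> bool"
  where "algebra_hom f \<longleftrightarrow> clinear f \<and> f 1 = 1 \<and> (\<forall>x y. f (x * y) = f x * f y)"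

definition subalgebra :: "'a::complex_algebra_1 set \<Rightarrow> bool"
  where "subalgebra A \<longleftrightarrow>
    complex_vector.subspace A \<and> 1 \<in> A \<and> (\<forall>x\<in>A. \<forall>y\<in>A. x * y \<in> A)"

instantiation complex :: complex_algebra_1
begin
definition scaleC_complex :: "complex \<Rightarrow> complex \<Rightarrow> complex"
  where "scaleC_complex = (*)"
instance by standard (simp_all add: scaleC_complex_def algebra_simps)
end


section \<open>The dual space\<close>

typedef (overloaded) 'a dual = "{f :: 'a::complex_vector \<Rightarrow> complex. clinear f}"
  morphisms dual_apply Abs_dual
proof
  show "(\<lambda>_. 0) \<in> {f. clinear f}" unfolding clinear_iff by (simp add: scaleC_complex_def)
qed

setup_lifting type_definition_dual

instantiation dual :: (complex_vector) complex_vector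
begin
lift_definition zero_dual :: "'a dual" is "\<lambda>_. 0"
  unfolding clinear_iff by (simp add: scaleC_complex_def)
lift_definition plus_dual :: "'a dual \<Rightarrow> 'a dual \<Rightarrow> 'a dual" is "\<lambda>f g x. f x + g x"
  unfolding clinear_iff by (simp add: scaleC_complex_def algebra_simps)
lift_definition minus_dual :: "'a dual \<Rightarrow> 'a dual \<Rightarrow> 'a dual" is "\<lambda>f g x. f x - g x"
  unfolding clinear_iff by (simp add: scaleC_complex_def algebra_simps)
lift_definition uminus_dual :: "'a dual \<Rightarrow> 'a dual" is "\<lambda>f x. - f x"
  unfolding clinear_iff by (simp add: scaleC_complex_def algebra_simps)
lift_definition scaleC_dual :: "complex \<Rightarrow> 'a dual \<Rightarrow> 'a dual" is "\<lambda>c f x. c * f x"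
  unfolding clinear_iff by (simp add: scaleC_complex_def algebra_simps)
instance
  by standard (transfer; simp add: fun_eq_iff algebra_simps)+
end


section \<open>The tensor product\<close>

instantiation poly_mapping :: (type, complex_vector) complex_vector
begin
lift_definition scaleC_poly_mapping :: "complex \<Rightarrow> ('a \<Rightarrow>\<^sub>0 'b) \<Rightarrow> ('a \<Rightarrow>\<^sub>0 'b)"
  is "\<lambda>c p k. c *\<^sub>C p k"
  by (rule finite_subset[rotated], assumption) (auto simp: complex_vector.scale_zero_right)
instance
  by standard (transfer; simp add: fun_eq_iff scaleC_add_right scaleC_add_left
      scaleC_scaleC scaleC_one)+
end

text \<open>The quotient of the vector space with basis \<open>'a \<times> 'b\<close> by the bilinearity relations.\<close>

definition tensor_relations :: "('a::complex_vector \<times> 'b::complex_vector \<Rightarrow>\<^sub>0 complex) set"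
  where "tensor_relations =
    {Poly_Mapping.single (x + x', y) 1 - Poly_Mapping.single (x, y) 1
       - Poly_Mapping.single (x', y) 1 | x x' y. True} \<union>
    {Poly_Mapping.single (x, y + y') 1 - Poly_Mapping.single (x, y) 1
       - Poly_Mapping.single (x, y') 1 | x y y'. True} \<union>
    {Poly_Mapping.single (c *\<^sub>C x, y) 1 - c *\<^sub>C Poly_Mapping.single (x, y) 1 | c x y. True} \<union>
    {Poly_Mapping.single (x, c *\<^sub>C y) 1 - c *\<^sub>C Poly_Mapping.single (x, y) 1 | c x y. True}"

definition tensor_eq ::
    "('a::complex_vector \<times> 'b::complex_vector \<Rightarrow>\<^sub>0 complex) \<Rightarrow> ('a \<times> 'b \<Rightarrow>\<^sub>0 complex) \<Rightarrow> bool"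
  where "tensor_eq p q \<longleftrightarrow> p - q \<in> complex_vector.span tensor_relations"

quotient_type (overloaded) ('a, 'b) tensor (infixr \<open>\<otimes>\<close> 70) =
  "'a::complex_vector \<times> 'b::complex_vector \<Rightarrow>\<^sub>0 complex" / tensor_eq
proof (rule equivpI)
  show "reflp (tensor_eq :: ('a \<times> 'b \<Rightarrow>\<^sub>0 complex) \<Rightarrow> _)"
    by (rule reflpI) (simp add: tensor_eq_def complex_vector.span_zero)
  show "symp (tensor_eq :: ('a \<times> 'b \<Rightarrow>\<^sub>0 complex) \<Rightarrow> _)"
  proof (rule sympI)
    fix p q :: "'a \<times> 'b \<Rightarrow>\<^sub>0 complex"
    assume "tensor_eq p q"
    then have "- (p - q) \<in> complex_vector.span tensor_relations"
      unfolding tensor_eq_def by (rule complex_vector.span_neg)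
    then show "tensor_eq q p" by (simp add: tensor_eq_def)
  qed
  show "transp (tensor_eq :: ('a \<times> 'b \<Rightarrow>\<^sub>0 complex) \<Rightarrow> _)"
  proof (rule transpI)
    fix p q r :: "'a \<times> 'b \<Rightarrow>\<^sub>0 complex"
    assume "tensor_eq p q" "tensor_eq q r"
    then have "(p - q) + (q - r) \<in> complex_vector.span tensor_relations"
      unfolding tensor_eq_def by (rule complex_vector.span_add)
    then show "tensor_eq p r" by (simp add: tensor_eq_def)
  qed
qed

instantiation tensor :: (complex_vector, complex_vector) complex_vector
begin
lift_definition zero_tensor :: "'a \<otimes> 'b" is 0 .
lift_definition plus_tensor :: "'a \<otimes> 'b \<Rightarrow> 'a \<otimes> 'b \<Rightarrow> 'a \<otimes> 'b" is "(+)"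
proof -
  fix p p' q q' :: "'a \<times> 'b \<Rightarrow>\<^sub>0 complex"
  assume "tensor_eq p p'" "tensor_eq q q'"
  then have "(p - p') + (q - q') \<in> complex_vector.span tensor_relations"
    unfolding tensor_eq_def by (rule complex_vector.span_add)
  then show "tensor_eq (p + q) (p' + q')"
    by (simp add: tensor_eq_def algebra_simps)
qed
lift_definition minus_tensor :: "'a \<otimes> 'b \<Rightarrow> 'a \<otimes> 'b \<Rightarrow> 'a \<otimes> 'b" is "(-)"
proof -
  fix p p' q q' :: "'a \<times> 'b \<Rightarrow>\<^sub>0 complex"
  assume "tensor_eq p p'" "tensor_eq q q'"
  then have "(p - p') - (q - q') \<in> complex_vector.span tensor_relations"
    unfolding tensor_eq_def by (rule complex_vector.span_diff)
  then show "tensor_eq (p - q) (p' - q')"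
    by (simp add: tensor_eq_def algebra_simps)
qed
lift_definition uminus_tensor :: "'a \<otimes> 'b \<Rightarrow> 'a \<otimes> 'b" is uminus
proof -
  fix p q :: "'a \<times> 'b \<Rightarrow>\<^sub>0 complex"
  assume "tensor_eq p q"
  then have "- (p - q) \<in> complex_vector.span tensor_relations"
    unfolding tensor_eq_def by (rule complex_vector.span_neg)
  then show "tensor_eq (- p) (- q)"
    by (simp add: tensor_eq_def)
qed
lift_definition scaleC_tensor :: "complex \<Rightarrow> 'a \<otimes> 'b \<Rightarrow> 'a \<otimes> 'b" is scaleC
proof -
  fix c and p q :: "'a \<times> 'b \<Rightarrow>\<^sub>0 complex"
  assume "tensor_eq p q"
  then have "c *\<^sub>C (p - q) \<in> complex_vector.span tensor_relations"
    unfolding tensor_eq_def by (rule complex_vector.span_scale)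
  then show "tensor_eq (c *\<^sub>C p) (c *\<^sub>C q)"
    by (simp add: tensor_eq_def complex_vector.scale_right_diff_distrib)
qed
instance
  by standard
    (transfer; simp add: tensor_eq_def scaleC_add_right scaleC_add_left complex_vector.span_zero)+
end

lift_definition pure_tensor :: "'a::complex_vector \<Rightarrow> 'b::complex_vector \<Rightarrow> 'a \<otimes> 'b"
    (infixr \<open>\<otimes>\<^sub>t\<close> 72)
  is "\<lambda>x y. Poly_Mapping.single (x, y) 1" .

definition tensor_lift ::
    "('a::complex_vector \<Rightarrow> 'b::complex_vector \<Rightarrow> 'c::complex_vector) \<Rightarrow> 'a \<otimes> 'b \<Rightarrow> 'c"
  where "tensor_lift B = (THE f. clinear f \<and> (\<forall>x y. f (x \<otimes>\<^sub>t y) = B x y))"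

lemma cbilinear_iff:
  "cbilinear B \<longleftrightarrow>
    (\<forall>x x' y. B (x + x') y = B x y + B x' y) \<and> (\<forall>x y y'. B x (y + y') = B x y + B x y') \<and>
    (\<forall>c x y. B (c *\<^sub>C x) y = c *\<^sub>C B x y) \<and> (\<forall>c x y. B x (c *\<^sub>C y) = c *\<^sub>C B x y)"
  unfolding cbilinear_def clinear_iff by blast

lemma cbilinear_pure_tensor: "cbilinear (\<otimes>\<^sub>t)"
proof -
  have relation: "tensor_eq p q" if "p - q \<in> tensor_relations"
    for p q :: "'a \<times> 'b \<Rightarrow>\<^sub>0 complex"
    unfolding tensor_eq_def using that by (rule complex_vector.span_base)
  have "(x + x') \<otimes>\<^sub>t y = x \<otimes>\<^sub>t y + x' \<otimes>\<^sub>t y" for x x' :: 'a and y :: 'b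
    by (transfer, rule relation, unfold tensor_relations_def diff_diff_eq[symmetric]) blast
  moreover have "x \<otimes>\<^sub>t (y + y') = x \<otimes>\<^sub>t y + x \<otimes>\<^sub>t y'" for x :: 'a and y y' :: 'b
    by (transfer, rule relation, unfold tensor_relations_def diff_diff_eq[symmetric]) blast
  moreover have "(c *\<^sub>C x) \<otimes>\<^sub>t y = c *\<^sub>C (x \<otimes>\<^sub>t y)" for c and x :: 'a and y :: 'b
    by (transfer, rule relation, unfold tensor_relations_def) blast
  moreover have "x \<otimes>\<^sub>t (c *\<^sub>C y) = c *\<^sub>C (x \<otimes>\<^sub>t y)" for c and x :: 'a and y :: 'b
    by (transfer, rule relation, unfold tensor_relations_def) blast
  ultimately show ?thesis
    unfolding cbilinear_iff by blast
qed

lemma clinear_tensor_eqI: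
  assumes f: "clinear f" and g: "clinear g" and eq: "\<And>x y. f (x \<otimes>\<^sub>t y) = g (x \<otimes>\<^sub>t y)"
  shows "f = g"
proof
  fix t
  show "f t = g t"
  proof (induction t rule: tensor.abs_induct)
    fix p :: "'a \<times> 'b \<Rightarrow>\<^sub>0 complex"
    have add: "abs_tensor (p + q) = abs_tensor p + abs_tensor q"
      for p q :: "'a \<times> 'b \<Rightarrow>\<^sub>0 complex"
      by (simp add: plus_tensor.abs_eq)
    have single: "abs_tensor (Poly_Mapping.single k c) = c *\<^sub>C (fst k \<otimes>\<^sub>t snd k)"
      for k :: "'a \<times> 'b" and c
    proof -
      have "Poly_Mapping.single k c = c *\<^sub>C Poly_Mapping.single k 1"
        by transfer (auto simp: scaleC_complex_def fun_eq_iff when_def)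
      then show ?thesis by (simp add: scaleC_tensor.abs_eq pure_tensor.abs_eq)
    qed
    show "f (abs_tensor p) = g (abs_tensor p)"
    proof (induction p rule: update_induct)
      case const
      have "abs_tensor 0 = (0 :: 'a \<otimes> 'b)" by (simp add: zero_tensor_def)
      then show ?case
        using complex_vector.linear_0[OF f] complex_vector.linear_0[OF g] by simp
    next
      case (update p k c)
      have "Poly_Mapping.update k c p = Poly_Mapping.single k c + p"
        by (rule poly_mapping_eqI) (use update.hyps in
          \<open>auto simp: lookup_update lookup_add lookup_single in_keys_iff\<close>)
      then show ?case
        using f g update.IH eq by (simp add: add single clinear_iff)
    qed
  qed
qed

lemma tensor_lift_exists:
  assumes B: "cbilinear B"
  shows "\<exists>f. clinear f \<and> (\<forall>x y. f (x \<otimes>\<^sub>t y) = B x y)"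
proof -
  define E where "E p = (\<Sum>k\<in>Poly_Mapping.keys p. Poly_Mapping.lookup p k *\<^sub>C B (fst k) (snd k))"
    for p :: "'a \<times> 'b \<Rightarrow>\<^sub>0 complex"
  have E_superset: "E p = (\<Sum>k\<in>A. Poly_Mapping.lookup p k *\<^sub>C B (fst k) (snd k))"
    if "finite A" "Poly_Mapping.keys p \<subseteq> A" for p A
    unfolding E_def using that
    by (intro sum.mono_neutral_left) (auto simp: in_keys_iff)
  have E_add: "E (p + q) = E p + E q" for p q
  proof -
    let ?A = "Poly_Mapping.keys p \<union> Poly_Mapping.keys q"
    have "E (p + q) = (\<Sum>k\<in>?A. Poly_Mapping.lookup (p + q) k *\<^sub>C B (fst k) (snd k))"
      by (rule E_superset) (simp_all add: Poly_Mapping.keys_add)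
    also have "\<dots> = (\<Sum>k\<in>?A. Poly_Mapping.lookup p k *\<^sub>C B (fst k) (snd k))
        + (\<Sum>k\<in>?A. Poly_Mapping.lookup q k *\<^sub>C B (fst k) (snd k))"
      by (simp add: lookup_add scaleC_add_left sum.distrib)
    also have "\<dots> = E p + E q"
      by (simp add: E_superset[of ?A])
    finally show ?thesis .
  qed
  have lookup_scale: "Poly_Mapping.lookup (c *\<^sub>C p) k = c * Poly_Mapping.lookup p k"
    for c and p :: "'a \<times> 'b \<Rightarrow>\<^sub>0 complex" and k
    by (simp add: scaleC_poly_mapping.rep_eq scaleC_complex_def)
  have E_scale: "E (c *\<^sub>C p) = c *\<^sub>C E p" for c p
  proof -
    have "E (c *\<^sub>C p)
        = (\<Sum>k\<in>Poly_Mapping.keys p. Poly_Mapping.lookup (c *\<^sub>C p) k *\<^sub>C B (fst k) (snd k))"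
      by (rule E_superset) (auto simp: in_keys_iff lookup_scale)
    then show ?thesis
      by (simp add: lookup_scale E_def complex_vector.scale_sum_right scaleC_scaleC)
  qed
  have E: "clinear E" by (simp add: clinear_iff E_add E_scale)
  have E_diff: "E (p - q) = E p - E q" for p q
    by (rule complex_vector.linear_diff[OF E])
  have E_single: "E (Poly_Mapping.single k 1) = B (fst k) (snd k)" for k
    by (simp add: E_def scaleC_one)
  have "E p = 0" if "p \<in> complex_vector.span tensor_relations" for p
  proof (rule complex_vector.linear_eq_0_on_span[OF E _ that])
    fix q :: "'a \<times> 'b \<Rightarrow>\<^sub>0 complex"
    assume "q \<in> tensor_relations"
    then show "E q = 0"
      using B unfolding tensor_relations_def cbilinear_iff
      by (auto simp: E_diff E_single E_scale)
  qed
  then have E_eq: "E p = E q" if "tensor_eq p q" for p q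
    using that by (metis E_diff eq_iff_diff_eq_0 tensor_eq_def)
  define f where "f t = E (rep_tensor t)" for t
  have f_abs: "f (abs_tensor p) = E p" for p
    unfolding f_def
    by (intro E_eq) (metis Quotient3_abs_rep Quotient3_tensor tensor.abs_eq_iff)
  have "f (s + t) = f s + f t" for s t
    by (induction s rule: tensor.abs_induct, induction t rule: tensor.abs_induct)
      (simp add: plus_tensor.abs_eq f_abs E_add)
  moreover have "f (c *\<^sub>C t) = c *\<^sub>C f t" for c t
    by (induction t rule: tensor.abs_induct) (simp add: scaleC_tensor.abs_eq f_abs E_scale)
  moreover have "f (x \<otimes>\<^sub>t y) = B x y" for x y
    by (simp add: pure_tensor.abs_eq f_abs E_single)
  ultimately show ?thesis unfolding clinear_iff by blast
qed

theorem tensor_universal_property: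
  assumes "cbilinear B"
  shows "\<exists>!f. clinear f \<and> (\<forall>x y. f (x \<otimes>\<^sub>t y) = B x y)"
  using tensor_lift_exists[OF assms] clinear_tensor_eqI by metis

lemma
  assumes "cbilinear B"
  shows clinear_tensor_lift: "clinear (tensor_lift B)"
    and tensor_lift_pure: "tensor_lift B (x \<otimes>\<^sub>t y) = B x y"
  using theI'[OF tensor_universal_property[OF assms]] unfolding tensor_lift_def by blast+

definition tensor_map ::
    "('a::complex_vector \<Rightarrow> 'c::complex_vector) \<Rightarrow> ('b::complex_vector \<Rightarrow> 'd::complex_vector)
      \<Rightarrow> 'a \<otimes> 'b \<Rightarrow> 'c \<otimes> 'd"
  where "tensor_map f g = tensor_lift (\<lambda>x y. f x \<otimes>\<^sub>t g y)"

definition tensor_flip :: "'a::complex_vector \<otimes> 'b::complex_vector \<Rightarrow> 'b \<otimes> 'a"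
  where "tensor_flip = tensor_lift (\<lambda>x y. y \<otimes>\<^sub>t x)"

definition tensor_assoc ::
    "('a::complex_vector \<otimes> 'b::complex_vector) \<otimes> 'c::complex_vector \<Rightarrow> 'a \<otimes> 'b \<otimes> 'c"
  where "tensor_assoc = tensor_lift (\<lambda>s z. tensor_lift (\<lambda>x y. x \<otimes>\<^sub>t y \<otimes>\<^sub>t z) s)"


section \<open>The tensor product of algebras\<close>

definition tensor_mult ::
    "'a::complex_algebra_1 \<otimes> 'b::complex_algebra_1 \<Rightarrow> 'a \<otimes> 'b \<Rightarrow> 'a \<otimes> 'b"
  where "tensor_mult s t =
    tensor_lift (\<lambda>x y. tensor_lift (\<lambda>x' y'. (x * x') \<otimes>\<^sub>t (y * y')) t) s"

lemma
  fixes x x' :: "'a::complex_algebra_1" and y y' :: "'b::complex_algebra_1"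
  shows cbilinear_tensor_mult: "cbilinear (tensor_mult :: 'a \<otimes> 'b \<Rightarrow> 'a \<otimes> 'b \<Rightarrow> 'a \<otimes> 'b)"
    and tensor_mult_pure: "tensor_mult (x \<otimes>\<^sub>t y) (x' \<otimes>\<^sub>t y') = (x * x') \<otimes>\<^sub>t (y * y')"
proof -
  note pure = cbilinear_pure_tensor[unfolded cbilinear_iff]
  have 1: "cbilinear (\<lambda>x' y'. (x * x') \<otimes>\<^sub>t (y * y'))" for x :: 'a and y :: 'b
    unfolding cbilinear_iff
    by (simp add: pure algebra_simps mult_scaleC_left mult_scaleC_right)
  define M where "M x y = tensor_lift (\<lambda>x' y'. (x * x') \<otimes>\<^sub>t (y * y'))" for x :: 'a and y :: 'b
  have M: "clinear (M x y)" for x y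
    unfolding M_def by (rule clinear_tensor_lift[OF 1])
  have M_pure: "M x y (x' \<otimes>\<^sub>t y') = (x * x') \<otimes>\<^sub>t (y * y')" for x y x' y'
    unfolding M_def by (rule tensor_lift_pure[OF 1])
  have M_add: "M x y (t + u) = M x y t + M x y u" and M_scale: "M x y (c *\<^sub>C t) = c *\<^sub>C M x y t"
    for x y t u c
    using M[of x y] by (simp_all add: clinear_iff)
  have 2: "cbilinear (\<lambda>x y. M x y t)" for t
  proof -
    have "M (x + z) y = (\<lambda>t. M x y t + M z y t)" for x z y
      by (rule clinear_tensor_eqI[OF M])
        (simp_all add: clinear_iff M_pure M_add M_scale pure algebra_simps scaleC_add_right)
    moreover have "M x (y + z) = (\<lambda>t. M x y t + M x z t)" for x z y
      by (rule clinear_tensor_eqI[OF M])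
        (simp_all add: clinear_iff M_pure M_add M_scale pure algebra_simps scaleC_add_right)
    moreover have "M (c *\<^sub>C x) y = (\<lambda>t. c *\<^sub>C M x y t)" for c x y
      by (rule clinear_tensor_eqI[OF M])
        (simp_all add: clinear_iff M_pure M_add M_scale pure scaleC_add_right mult_scaleC_left
          scaleC_scaleC mult.commute)
    moreover have "M x (c *\<^sub>C y) = (\<lambda>t. c *\<^sub>C M x y t)" for c x y
      by (rule clinear_tensor_eqI[OF M])
        (simp_all add: clinear_iff M_pure M_add M_scale pure scaleC_add_right mult_scaleC_left
          scaleC_scaleC mult.commute)
    ultimately show ?thesis
      unfolding cbilinear_iff by metis
  qed
  have mult_M: "tensor_mult s t = tensor_lift (\<lambda>x y. M x y t) s" for s t
    unfolding tensor_mult_def M_def ..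
  have mult_pure: "tensor_mult (x \<otimes>\<^sub>t y) t = M x y t" for x y t
    unfolding mult_M by (rule tensor_lift_pure[OF 2])
  show "tensor_mult (x \<otimes>\<^sub>t y) (x' \<otimes>\<^sub>t y') = (x * x') \<otimes>\<^sub>t (y * y')"
    by (simp add: mult_pure M_pure)
  have left: "clinear (\<lambda>s. tensor_mult s t)" for t :: "'a \<otimes> 'b"
    unfolding mult_M by (rule clinear_tensor_lift[OF 2])
  have left': "tensor_mult (s + u) t = tensor_mult s t + tensor_mult u t"
    "tensor_mult (c *\<^sub>C s) t = c *\<^sub>C tensor_mult s t" for s t u :: "'a \<otimes> 'b" and c
    using left[of t] by (simp_all add: clinear_iff)
  have right: "clinear (tensor_mult s)" for s :: "'a \<otimes> 'b"
  proof -
    have "(\<lambda>s. tensor_mult s (t + u)) = (\<lambda>s. tensor_mult s t + tensor_mult s u)"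
      for t u :: "'a \<otimes> 'b"
      by (rule clinear_tensor_eqI[OF left])
        (simp_all add: clinear_iff left' mult_pure M_add scaleC_add_right)
    moreover have "(\<lambda>s. tensor_mult s (c *\<^sub>C t)) = (\<lambda>s. c *\<^sub>C tensor_mult s t)"
      for c and t :: "'a \<otimes> 'b"
      by (rule clinear_tensor_eqI[OF left])
        (simp_all add: clinear_iff left' mult_pure M_scale scaleC_add_right scaleC_scaleC
          mult.commute)
    ultimately show ?thesis unfolding clinear_iff by metis
  qed
  show "cbilinear (tensor_mult :: 'a \<otimes> 'b \<Rightarrow> _)"
    unfolding cbilinear_def using left right by blast
qed

lemma unital_functional_exists:
  "\<exists>f :: 'a::complex_algebra_1 \<Rightarrow> complex. clinear f \<and> f 1 = 1"
  using complex_vector.linear_independent_extend[of "{1 :: 'a}" "\<lambda>_. 1 :: complex"]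
  by (auto simp: complex_vector.independent_insert)

instantiation tensor :: (complex_algebra_1, complex_algebra_1) complex_algebra_1
begin

definition one_tensor :: "'a \<otimes> 'b" where "one_tensor = 1 \<otimes>\<^sub>t 1"

definition times_tensor :: "'a \<otimes> 'b \<Rightarrow> 'a \<otimes> 'b \<Rightarrow> 'a \<otimes> 'b" where "times_tensor = tensor_mult"

instance
proof
  note bil = cbilinear_tensor_mult[unfolded cbilinear_iff]
  fix s t u :: "'a \<otimes> 'b" and c :: complex
  show "(s + t) * u = s * u + t * u" "s * (t + u) = s * t + s * u"
    "(c *\<^sub>C s) * t = c *\<^sub>C (s * t)" "s * (c *\<^sub>C t) = c *\<^sub>C (s * t)"
    by (simp_all add: times_tensor_def bil)
  have lin: "clinear (\<lambda>s :: 'a \<otimes> 'b. s * t)" "clinear (\<lambda>s. t * s)" for t :: "'a \<otimes> 'b"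
    by (simp_all add: times_tensor_def clinear_iff bil)
  have pure: "(x \<otimes>\<^sub>t y) * (x' \<otimes>\<^sub>t y') = (x * x') \<otimes>\<^sub>t (y * y')" for x x' :: 'a and y y' :: 'b
    by (simp add: times_tensor_def tensor_mult_pure)
  have id: "clinear (\<lambda>s :: 'a \<otimes> 'b. s)" by (simp add: clinear_iff)
  have "(\<lambda>s :: 'a \<otimes> 'b. 1 * s) = (\<lambda>s. s)"
    by (rule clinear_tensor_eqI[OF lin(2) id]) (simp add: one_tensor_def pure)
  then show "1 * s = s" by metis
  have "(\<lambda>s :: 'a \<otimes> 'b. s * 1) = (\<lambda>s. s)"
    by (rule clinear_tensor_eqI[OF lin(1) id]) (simp add: one_tensor_def pure)
  then show "s * 1 = s" by metis
  have comp: "clinear (\<lambda>s :: 'a \<otimes> 'b. s * t * u)" "clinear (\<lambda>s :: 'a \<otimes> 'b. t * s * u)"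
    "clinear (\<lambda>s :: 'a \<otimes> 'b. t * (s * u))" "clinear (\<lambda>s :: 'a \<otimes> 'b. t * (u * s))"
    for t u :: "'a \<otimes> 'b"
    using lin by (simp_all add: clinear_iff)
  have "(\<lambda>u. (x \<otimes>\<^sub>t y) * (x' \<otimes>\<^sub>t y') * u) = (\<lambda>u. (x \<otimes>\<^sub>t y) * ((x' \<otimes>\<^sub>t y') * u))"
    for x x' :: 'a and y y' :: 'b
    by (rule clinear_tensor_eqI[OF lin(2) comp(4)]) (simp add: pure mult.assoc)
  then have "(\<lambda>t. (x \<otimes>\<^sub>t y) * t * u) = (\<lambda>t. (x \<otimes>\<^sub>t y) * (t * u))"
    for x :: 'a and y :: 'b and u
    by (intro clinear_tensor_eqI[OF comp(2) comp(3)]) metis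
  then have "(\<lambda>s. s * t * u) = (\<lambda>s. s * (t * u))"
    by (intro clinear_tensor_eqI[OF comp(1) lin(1)]) metis
  then show "s * t * u = s * (t * u)" by metis
  obtain f :: "'a \<Rightarrow> complex" and g :: "'b \<Rightarrow> complex"
    where f: "clinear f" "f 1 = 1" and g: "clinear g" "g 1 = 1"
    using unital_functional_exists by metis
  have "cbilinear (\<lambda>x y. f x * g y)"
    using f(1) g(1) unfolding clinear_iff cbilinear_iff
    by (simp add: scaleC_complex_def algebra_simps)
  from clinear_tensor_lift[OF this] tensor_lift_pure[OF this, of 1 1] f g
  show "(0 :: 'a \<otimes> 'b) \<noteq> 1"
    by (metis complex_vector.linear_0 mult_1 one_tensor_def zero_neq_one)
qed

end


section \<open>Hopf algebras and universal R-matrices\<close>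

definition hopf_algebra ::
    "('a::complex_algebra_1 \<Rightarrow> 'a \<otimes> 'a) \<Rightarrow> ('a \<Rightarrow> complex) \<Rightarrow> ('a \<Rightarrow> 'a) \<Rightarrow> bool"
  where "hopf_algebra \<Delta> \<epsilon> S \<longleftrightarrow>
    algebra_hom \<Delta> \<and> algebra_hom \<epsilon> \<and> clinear S \<and>
    (\<forall>x. tensor_assoc (tensor_map \<Delta> id (\<Delta> x)) = tensor_map id \<Delta> (\<Delta> x)) \<and>
    (\<forall>x. tensor_lift (\<lambda>y z. \<epsilon> y *\<^sub>C z) (\<Delta> x) = x) \<and>
    (\<forall>x. tensor_lift (\<lambda>y z. \<epsilon> z *\<^sub>C y) (\<Delta> x) = x) \<and>
    (\<forall>x. tensor_lift (\<lambda>y z. S y * z) (\<Delta> x) = \<epsilon> x *\<^sub>C 1) \<and>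
    (\<forall>x. tensor_lift (\<lambda>y z. y * S z) (\<Delta> x) = \<epsilon> x *\<^sub>C 1)"

definition leg12 :: "'a::complex_algebra_1 \<otimes> 'a \<Rightarrow> 'a \<otimes> 'a \<otimes> 'a"
  where "leg12 = tensor_lift (\<lambda>x y. x \<otimes>\<^sub>t y \<otimes>\<^sub>t 1)"

definition leg13 :: "'a::complex_algebra_1 \<otimes> 'a \<Rightarrow> 'a \<otimes> 'a \<otimes> 'a"
  where "leg13 = tensor_lift (\<lambda>x y. x \<otimes>\<^sub>t 1 \<otimes>\<^sub>t y)"

definition leg23 :: "'a::complex_algebra_1 \<otimes> 'a \<Rightarrow> 'a \<otimes> 'a \<otimes> 'a"
  where "leg23 = tensor_lift (\<lambda>x y. 1 \<otimes>\<^sub>t x \<otimes>\<^sub>t y)"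

definition universal_R_matrix ::
    "('a::complex_algebra_1 \<Rightarrow> 'a \<otimes> 'a) \<Rightarrow> 'a \<otimes> 'a \<Rightarrow> bool"
  where "universal_R_matrix \<Delta> R \<longleftrightarrow>
    (\<exists>R'. R * R' = 1 \<and> R' * R = 1 \<and> (\<forall>x. tensor_flip (\<Delta> x) = R * \<Delta> x * R')) \<and>
    tensor_assoc (tensor_map \<Delta> id R) = leg13 R * leg23 R \<and>
    tensor_map id \<Delta> R = leg13 R * leg12 R"

definition quasitriangular_hopf_algebra ::
    "('a::complex_algebra_1 \<Rightarrow> 'a \<otimes> 'a) \<Rightarrow> ('a \<Rightarrow> complex) \<Rightarrow> ('a \<Rightarrow> 'a) \<Rightarrow> 'a \<otimes> 'a \<Rightarrow> bool"
  where "quasitriangular_hopf_algebra \<Delta> \<epsilon> S R \<longleftrightarrow>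
    hopf_algebra \<Delta> \<epsilon> S \<and> universal_R_matrix \<Delta> R"

definition drinfeld_map :: "'a::complex_algebra_1 \<otimes> 'a \<Rightarrow> 'a dual \<Rightarrow> 'a"
  where "drinfeld_map R f = tensor_lift (\<lambda>x y. dual_apply f y *\<^sub>C x) (tensor_flip R * R)"

definition factorizable ::
    "('a::complex_algebra_1 \<Rightarrow> 'a \<otimes> 'a) \<Rightarrow> ('a \<Rightarrow> complex) \<Rightarrow> ('a \<Rightarrow> 'a) \<Rightarrow> bool"
  where "factorizable \<Delta> \<epsilon> S \<longleftrightarrow>
    (\<exists>R. quasitriangular_hopf_algebra \<Delta> \<epsilon> S R \<and> vector_space_iso (drinfeld_map R))"


section \<open>Nichols Hopf algebras\<close>

text \<open>
  The relations bound the dimension of an algebra generated by \<open>K, \<xi>\<^sub>1, \<dots>, \<xi>\<^sub>m\<close>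
  by \<open>2 ^ (m + 1)\<close>, so requiring this dimension excludes further relations and determines
  the Hopf algebra up to isomorphism.  Only \<open>\<xi> 1, \<dots>, \<xi> m\<close> matter.  Since
  \<open>complex_vector.dim\<close> is 0 in infinite dimension, the condition implies finite dimension.
\<close>

definition nichols_hopf_algebra ::
    "nat \<Rightarrow> ('a::complex_algebra_1 \<Rightarrow> 'a \<otimes> 'a) \<Rightarrow> ('a \<Rightarrow> complex) \<Rightarrow> ('a \<Rightarrow> 'a)
      \<Rightarrow> 'a \<Rightarrow> (nat \<Rightarrow> 'a) \<Rightarrow> bool"
  where "nichols_hopf_algebra m \<Delta> \<epsilon> S K \<xi> \<longleftrightarrow>
    hopf_algebra \<Delta> \<epsilon> S \<and>
    complex_vector.dim (UNIV :: 'a set) = 2 ^ (m + 1) \<and>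
    subalgebra hull (insert K (\<xi> ` {1..m})) = UNIV \<and>
    K ^ 2 = 1 \<and>
    (\<forall>i\<in>{1..m}. \<xi> i ^ 2 = 0) \<and>
    (\<forall>i\<in>{1..m}. K * \<xi> i = - (\<xi> i * K)) \<and>
    (\<forall>i\<in>{1..m}. \<forall>j\<in>{1..m}. \<xi> i * \<xi> j = - (\<xi> j * \<xi> i)) \<and>
    \<Delta> K = K \<otimes>\<^sub>t K \<and>
    (\<forall>i\<in>{1..m}. \<Delta> (\<xi> i) = K \<otimes>\<^sub>t \<xi> i + \<xi> i \<otimes>\<^sub>t 1) \<and>
    \<epsilon> K = 1 \<and>
    (\<forall>i\<in>{1..m}. \<epsilon> (\<xi> i) = 0) \<and>
    S K = K \<and>
    (\<forall>i\<in>{1..m}. S (\<xi> i) = - (K * \<xi> i))"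

text \<open>
  A word \<open>\<xi>\<^sub>i\<^sub>1 \<dots> \<xi>\<^sub>i\<^sub>k\<close> with \<open>i\<^sub>1 < \<dots> < i\<^sub>k\<close> is represented by
  the set \<open>I\<close> of its indices; in particular its length is \<open>card I\<close>.
\<close>

definition xi_word :: "(nat \<Rightarrow> 'a::complex_algebra_1) \<Rightarrow> nat set \<Rightarrow> 'a"
  where "xi_word \<xi> I = prod_list (map \<xi> (sorted_list_of_set I))"

definition nichols_R :: "nat \<Rightarrow> 'a::complex_algebra_1 \<Rightarrow> (nat \<Rightarrow> 'a) \<Rightarrow> 'a \<otimes> 'a"
  where "nichols_R n K \<xi> =
    (\<Sum>I\<in>Pow {1..n}. (-1) ^ (card I div 2) *\<^sub>C
       (xi_word \<xi> I \<otimes>\<^sub>t (xi_word (\<lambda>i. \<xi> (i + n)) I * K ^ card I)))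
    * ((1 / 2) *\<^sub>C (1 \<otimes>\<^sub>t 1 + K \<otimes>\<^sub>t 1 + 1 \<otimes>\<^sub>t K - K \<otimes>\<^sub>t K))"

end

theory Submission
  imports Defs
begin

text \<open>
  Let \<open>J\<close> be the ideal generated by the \<open>\<xi>\<^sub>i\<close>; its elements are nilpotent, and modulo \<open>J\<close> only \<open>1\<close> and
  \<open>K\<close> survive.  Hence there is a character \<open>\<chi> \<noteq> \<epsilon>\<close> with \<open>\<chi>(K) = -1\<close> and \<open>\<chi>(\<xi>\<^sub>i) = 0\<close>, and \<open>\<chi>\<close> has
  convolution square \<open>\<epsilon>\<close>.  For a universal R-matrix \<open>R\<close> put \<open>a = (id \<otimes> \<chi>)(R)\<close> and
  \<open>b = (\<chi> \<otimes> id)(R)\<close>.  Then \<open>a\<^sup>2 = b\<^sup>2 = 1\<close>, and the Drinfeld map sends \<open>\<epsilon>\<close> to \<open>1\<close> and \<open>\<chi>\<close> to \<open>g = b a\<close>.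
  Since \<open>R\<^sub>2\<^sub>1 R\<close> commutes with the coproduct, \<open>g\<close> is central, so \<open>a\<close> and \<open>b\<close> commute and \<open>g\<^sup>2 = 1\<close>.
  Moreover \<open>\<epsilon>(g) = 1\<close> and \<open>\<chi>(g) = \<chi>(a)\<^sup>2 = 1\<close>, so the idempotent \<open>(1 - g)/2\<close> lies in \<open>J\<close> and
  vanishes.  Thus \<open>\<chi>\<close> and \<open>\<epsilon>\<close> have the same image.  For \<open>nichols_R\<close> one has \<open>a = b = K\<close>, with the same
  conclusion.
\<close>

section \<open>Algebra homomorphisms and generators\<close>

lemma clinear_id: "clinear (\<lambda>x. x)"
  by (simp add: clinear_iff)

lemma scaleC_complex_mult: "c *\<^sub>C (z :: complex) = c * z"
  by (simp add: scaleC_complex_def)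

lemma algebra_homD:
  assumes "algebra_hom f"
  shows "clinear f" "f 1 = 1" "f (x * y) = f x * f y"
    "f (x + y) = f x + f y" "f (c *\<^sub>C x) = c *\<^sub>C f x"
  using assms unfolding algebra_hom_def clinear_iff by blast+

lemma algebra_hom_compose:
  assumes "algebra_hom f" "algebra_hom g"
  shows "algebra_hom (\<lambda>x. f (g x))"
  using assms by (simp add: algebra_hom_def clinear_iff)

text \<open>The elements satisfying \<open>P\<close> form a subalgebra containing \<open>G\<close>;
  its zero comes from scaling \<open>1\<close> by 0, so no case for 0 is required.\<close>

lemma generated_algebra_induct [case_names generated add scale one mult generator]:
  assumes "subalgebra hull G = UNIV"
    and add: "\<And>x y. P x \<Longrightarrow> P y \<Longrightarrow> P (x + y)" and scale: "\<And>c x. P x \<Longrightarrow> P (c *\<^sub>C x)"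
    and one: "P 1" and mult: "\<And>x y. P x \<Longrightarrow> P y \<Longrightarrow> P (x * y)"
    and generator: "\<And>x. x \<in> G \<Longrightarrow> P x"
  shows "P x"
proof -
  have "P 0"
    using scale[OF one, of 0] by (simp add: complex_vector.scale_zero_left)
  then have "subalgebra (Collect P)"
    by (simp add: subalgebra_def complex_vector.subspace_def add scale one mult)
  moreover have "G \<subseteq> Collect P"
    using generator by blast
  ultimately have "subalgebra hull G \<subseteq> Collect P"
    by (intro hull_minimal)
  then show ?thesis
    using assms(1) by blast
qed

lemma algebra_hom_eqI:
  assumes "subalgebra hull G = UNIV" and f: "algebra_hom f" and g: "algebra_hom g"
    and "\<And>x. x \<in> G \<Longrightarrow> f x = g x"
  shows "f x = g x"
  using assms(1)
  by (rule generated_algebra_induct) (simp_all add: algebra_homD[OF f] algebra_homD[OF g] assms(4))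

text \<open>A basis of \<open>J\<close> stays independent after adjoining \<open>e\<close>, so the
  values 0 on the basis and 1 at \<open>e\<close> extend linearly.\<close>

lemma separating_functional:
  assumes J: "complex_vector.subspace J" and "e \<notin> J"
  obtains \<phi> :: "'a::complex_vector \<Rightarrow> complex"
  where "clinear \<phi>" "\<And>x. x \<in> J \<Longrightarrow> \<phi> x = 0" "\<phi> e = 1"
proof -
  obtain B where B: "B \<subseteq> J" "complex_vector.independent B" "J \<subseteq> complex_vector.span B"
    using complex_vector.maximal_independent_subset by blast
  have span: "complex_vector.span B = J"
    using B(1,3) J by (rule complex_vector.span_subspace)
  have e: "e \<notin> B"
    using B(1) \<open>e \<notin> J\<close> by blast
  then have "complex_vector.independent (insert e B)"
    by (simp add: complex_vector.independent_insert B(2) span \<open>e \<notin> J\<close>)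
  from complex_vector.linear_independent_extend[OF this, of "\<lambda>x. if x = e then 1 else 0"]
  obtain \<phi> :: "'a \<Rightarrow> complex"
    where \<phi>: "clinear \<phi>" "\<forall>x\<in>insert e B. \<phi> x = (if x = e then 1 else 0)"
    by (elim exE conjE)
  show ?thesis
  proof
    have "\<phi> x = 0" if "x \<in> B" for x
      using \<phi>(2) e that by auto
    then show "\<phi> x = 0" if "x \<in> J" for x
      using that[folded span] by (rule complex_vector.linear_eq_0_on_span[OF \<phi>(1)])
    show "\<phi> e = 1"
      using \<phi>(2) by simp
  qed (rule \<phi>(1))
qed

text \<open>Each \<open>z k\<close> can be moved to the right end of a product, so powers of
  \<open>h k * z k + y\<close> agree with powers of \<open>y\<close> up to a left multiple of
  \<open>z k\<close>. Once the power of \<open>y\<close> vanishes, only \<open>w * z k\<close> is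
  left, and its square contains \<open>z k * z k = 0\<close>. Adding one element thus doubles the
  exponent.\<close>

lemma sum_normal_square_zero_nilpotent:
  fixes z :: "'i \<Rightarrow> 'a::ring_1"
  assumes "finite A" "\<And>i. i \<in> A \<Longrightarrow> z i * z i = 0" "\<And>i x. i \<in> A \<Longrightarrow> \<exists>y. z i * x = y * z i"
  shows "\<exists>N. (\<Sum>i\<in>A. h i * z i) ^ N = 0"
  using assms
proof (induction A)
  case empty
  then show ?case by (auto intro: exI[of _ 1])
next
  case (insert k A)
  let ?y = "\<Sum>i\<in>A. h i * z i"
  let ?x = "h k * z k + ?y"
  have pow: "\<exists>w. ?x ^ N = ?y ^ N + w * z k" for N
  proof (induction N)
    case 0
    then show ?case by (auto intro: exI[of _ 0])
  next
    case (Suc N)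
    then obtain w where w: "?x ^ N = ?y ^ N + w * z k" by blast
    obtain u v where u: "z k * ?y ^ N = u * z k" and v: "z k * w = v * z k"
      using insert.prems(2) by (meson insertI1)
    have "?x ^ Suc N = h k * (z k * ?y ^ N) + h k * (z k * w) * z k + ?y * ?y ^ N + ?y * w * z k"
      by (simp add: w algebra_simps)
    also have "\<dots> = ?y ^ Suc N + (h k * u + ?y * w) * z k"
      using insert.prems(1)[of k] by (simp add: u v algebra_simps)
    finally show ?case by blast
  qed
  obtain N where "?y ^ N = 0"
    using insert by blast
  then obtain w where w: "?x ^ N = w * z k"
    using pow[of N] by auto
  obtain v where "z k * w = v * z k"
    using insert.prems(2) by blast
  then have "w * z k * (w * z k) = w * v * (z k * z k)"
    by (metis mult.assoc)
  then have "?x ^ (N + N) = 0"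
    using insert.prems(1)[of k] by (simp add: power_add w)
  then show ?case
    using insert.hyps by auto
qed

section \<open>Contraction of tensors\<close>

lemma pure_tensor_mult: "(x \<otimes>\<^sub>t y) * (x' \<otimes>\<^sub>t y') = (x * x') \<otimes>\<^sub>t (y * y')"
  by (simp add: times_tensor_def tensor_mult_pure)

lemmas pure_tensor_bilinear = cbilinear_pure_tensor[unfolded cbilinear_iff]

lemma clinear_tensor_ext:
  assumes "clinear f" "clinear g" "\<And>x y. f (x \<otimes>\<^sub>t y) = g (x \<otimes>\<^sub>t y)"
  shows "f t = g t"
  using clinear_tensor_eqI[OF assms] by simp

text \<open>Both sides of the multiplicativity equation are linear in each argument, so it passes
  from pure tensors to all tensors one argument at a time.\<close>

lemma algebra_hom_tensorI:
  fixes f :: "'a::complex_algebra_1 \<otimes> 'b::complex_algebra_1 \<Rightarrow> 'c::complex_algebra_1"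
  assumes f: "clinear f" and one: "f (1 \<otimes>\<^sub>t 1) = 1"
    and mult: "\<And>x y x' y'. f ((x * x') \<otimes>\<^sub>t (y * y')) = f (x \<otimes>\<^sub>t y) * f (x' \<otimes>\<^sub>t y')"
  shows "algebra_hom f"
proof -
  note lin = f[unfolded clinear_iff, THEN conjunct1, rule_format]
    f[unfolded clinear_iff, THEN conjunct2, rule_format]
  note simps = clinear_iff lin algebra_simps mult_scaleC_left mult_scaleC_right
  have "f ((x \<otimes>\<^sub>t y) * t) = f (x \<otimes>\<^sub>t y) * f t" for x y t
    by (rule clinear_tensor_ext[of "\<lambda>t. f ((x \<otimes>\<^sub>t y) * t)"])
      (simp_all add: simps pure_tensor_mult mult)
  then have "f (s * t) = f s * f t" for s t
    by - (rule clinear_tensor_ext[of "\<lambda>s. f (s * t)" "\<lambda>s. f s * f t"], simp_all add: simps)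
  then show ?thesis
    using f one by (simp add: algebra_hom_def one_tensor_def)
qed

text \<open>The slice map id \<otimes> f, with the scalar factor absorbed into the remaining leg;
  \<open>contract_left\<close> is f \<otimes> id.\<close>

definition contract_right :: "('b::complex_vector \<Rightarrow> complex) \<Rightarrow> 'a::complex_vector \<otimes> 'b \<Rightarrow> 'a"
  where "contract_right f = tensor_lift (\<lambda>x y. f y *\<^sub>C x)"

definition contract_left :: "('a::complex_vector \<Rightarrow> complex) \<Rightarrow> 'a \<otimes> 'b::complex_vector \<Rightarrow> 'b"
  where "contract_left f = tensor_lift (\<lambda>x y. f x *\<^sub>C y)"

lemma
  assumes "clinear f"
  shows clinear_contract_right: "clinear (contract_right f)"
    and contract_right_pure: "contract_right f (x \<otimes>\<^sub>t y) = f y *\<^sub>C x"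
    and clinear_contract_left: "clinear (contract_left f)"
    and contract_left_pure: "contract_left f (y \<otimes>\<^sub>t x) = f y *\<^sub>C x"
proof -
  have "cbilinear (\<lambda>x y. f y *\<^sub>C x)" "cbilinear (\<lambda>y x. f y *\<^sub>C x)"
    using assms unfolding cbilinear_iff clinear_iff
    by (simp_all add: scaleC_add_left scaleC_add_right scaleC_scaleC scaleC_complex_mult mult.commute)
  from this[THEN clinear_tensor_lift] this[THEN tensor_lift_pure]
  show "clinear (contract_right f)" "contract_right f (x \<otimes>\<^sub>t y) = f y *\<^sub>C x"
    "clinear (contract_left f)" "contract_left f (y \<otimes>\<^sub>t x) = f y *\<^sub>C x"
    unfolding contract_right_def contract_left_def by simp_all
qed

text \<open>Slicing by a character is multiplicative because the scalars it produces are central.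
  This turns identities for R into identities in the Hopf algebra.\<close>

lemma
  assumes f: "algebra_hom f"
  shows algebra_hom_contract_right:
      "algebra_hom (contract_right f :: 'a::complex_algebra_1 \<otimes> 'b::complex_algebra_1 \<Rightarrow> 'a)"
    and algebra_hom_contract_left:
      "algebra_hom (contract_left f :: 'b \<otimes> 'a \<Rightarrow> 'a)"
  by (rule algebra_hom_tensorI;
      simp add: clinear_contract_right clinear_contract_left contract_right_pure contract_left_pure
        algebra_homD[OF f] scaleC_one mult_scaleC_left mult_scaleC_right scaleC_scaleC mult.commute)+

lemma
  shows clinear_tensor_flip: "clinear tensor_flip"
    and tensor_flip_pure: "tensor_flip (x \<otimes>\<^sub>t y) = y \<otimes>\<^sub>t x"
proof -
  have "cbilinear (\<lambda>x y. y \<otimes>\<^sub>t x)"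
    unfolding cbilinear_iff by (simp add: pure_tensor_bilinear)
  from clinear_tensor_lift[OF this] tensor_lift_pure[OF this]
  show "clinear tensor_flip" "tensor_flip (x \<otimes>\<^sub>t y) = y \<otimes>\<^sub>t x"
    unfolding tensor_flip_def by simp_all
qed

lemma algebra_hom_tensor_flip: "algebra_hom tensor_flip"
  by (rule algebra_hom_tensorI)
    (simp_all add: clinear_tensor_flip tensor_flip_pure pure_tensor_mult one_tensor_def)

lemma contract_right_flip:
  assumes "clinear f"
  shows "contract_right f (tensor_flip t) = contract_left f t"
  by (rule clinear_tensor_ext[of "\<lambda>t. contract_right f (tensor_flip t)"])
    (simp_all add: clinear_contract_left[OF assms, unfolded clinear_iff] contract_left_pure[OF assms]
      contract_right_pure[OF assms] tensor_flip_pure clinear_iff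
      clinear_tensor_flip[unfolded clinear_iff]
      clinear_contract_right[OF assms, unfolded clinear_iff])

text \<open>Both sides are f \<otimes> g evaluated at \<open>t\<close>.\<close>

lemma contract_swap:
  fixes f :: "'a::complex_vector \<Rightarrow> complex" and g :: "'b::complex_vector \<Rightarrow> complex"
  assumes f: "clinear f" and g: "clinear g"
  shows "f (contract_right g t) = g (contract_left f t)"
  by (rule clinear_tensor_ext[of "\<lambda>t. f (contract_right g t)"])
    (simp_all add: clinear_iff clinear_contract_left[OF f, unfolded clinear_iff]
      clinear_contract_right[OF g, unfolded clinear_iff] f[unfolded clinear_iff]
      g[unfolded clinear_iff] contract_left_pure[OF f] contract_right_pure[OF g]
      scaleC_complex_mult)

lemma tensor_flip_flip: "tensor_flip (tensor_flip t) = t"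
  by (rule clinear_tensor_ext[of "\<lambda>t. tensor_flip (tensor_flip t)" "\<lambda>t. t"])
    (simp_all add: clinear_iff clinear_tensor_flip[unfolded clinear_iff] tensor_flip_pure)

text \<open>The functional f \<otimes> g; composed with a coproduct it is the convolution product of
  \<open>f\<close> and \<open>g\<close>.\<close>

definition functional_tensor ::
    "('a::complex_algebra_1 \<Rightarrow> complex) \<Rightarrow> ('b::complex_algebra_1 \<Rightarrow> complex) \<Rightarrow> 'a \<otimes> 'b \<Rightarrow> complex"
  where "functional_tensor f g t = g (contract_left f t)"

lemma functional_tensor:
  assumes f: "algebra_hom f" and g: "algebra_hom g"
  shows algebra_hom_functional_tensor: "algebra_hom (functional_tensor f g)"
    and functional_tensor_pure: "functional_tensor f g (x \<otimes>\<^sub>t y) = f x * g y"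
proof -
  have "algebra_hom (\<lambda>t. functional_tensor f g t)"
    unfolding functional_tensor_def
    by (rule algebra_hom_compose[OF g algebra_hom_contract_left[OF f]])
  then show "algebra_hom (functional_tensor f g)" .
  show "functional_tensor f g (x \<otimes>\<^sub>t y) = f x * g y"
    by (simp add: functional_tensor_def contract_left_pure[OF algebra_homD(1)[OF f]]
        algebra_homD(5)[OF g] scaleC_complex_mult)
qed

section \<open>Tensor products of maps, the three legs and the associator\<close>

lemma
  assumes "clinear f" "clinear g"
  shows clinear_tensor_map: "clinear (tensor_map f g)"
    and tensor_map_pure: "tensor_map f g (x \<otimes>\<^sub>t y) = f x \<otimes>\<^sub>t g y"
proof -
  have "cbilinear (\<lambda>x y. f x \<otimes>\<^sub>t g y)"
    using assms unfolding cbilinear_iff clinear_iff by (simp add: pure_tensor_bilinear)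
  from clinear_tensor_lift[OF this] tensor_lift_pure[OF this]
  show "clinear (tensor_map f g)" "tensor_map f g (x \<otimes>\<^sub>t y) = f x \<otimes>\<^sub>t g y"
    unfolding tensor_map_def by simp_all
qed

lemma
  shows clinear_leg12: "clinear leg12" and leg12_pure: "leg12 (x \<otimes>\<^sub>t y) = x \<otimes>\<^sub>t y \<otimes>\<^sub>t 1"
    and clinear_leg13: "clinear leg13" and leg13_pure: "leg13 (x \<otimes>\<^sub>t y) = x \<otimes>\<^sub>t 1 \<otimes>\<^sub>t y"
    and clinear_leg23: "clinear leg23" and leg23_pure: "leg23 (x \<otimes>\<^sub>t y) = 1 \<otimes>\<^sub>t x \<otimes>\<^sub>t y"
proof -
  have "cbilinear (\<lambda>x y. x \<otimes>\<^sub>t y \<otimes>\<^sub>t 1)" "cbilinear (\<lambda>x y. x \<otimes>\<^sub>t 1 \<otimes>\<^sub>t y)"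
    "cbilinear (\<lambda>x y. 1 \<otimes>\<^sub>t x \<otimes>\<^sub>t y)"
    unfolding cbilinear_iff by (simp_all add: pure_tensor_bilinear)
  from this[THEN clinear_tensor_lift] this[THEN tensor_lift_pure]
  show "clinear leg12" "leg12 (x \<otimes>\<^sub>t y) = x \<otimes>\<^sub>t y \<otimes>\<^sub>t 1"
    "clinear leg13" "leg13 (x \<otimes>\<^sub>t y) = x \<otimes>\<^sub>t 1 \<otimes>\<^sub>t y"
    "clinear leg23" "leg23 (x \<otimes>\<^sub>t y) = 1 \<otimes>\<^sub>t x \<otimes>\<^sub>t y"
    unfolding leg12_def leg13_def leg23_def by simp_all
qed

lemma
  fixes x :: "'a::complex_vector" and y :: "'b::complex_vector" and z :: "'c::complex_vector"
  shows clinear_tensor_assoc: "clinear (tensor_assoc :: ('a \<otimes> 'b) \<otimes> 'c \<Rightarrow> 'a \<otimes> 'b \<otimes> 'c)"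
    and tensor_assoc_pure: "tensor_assoc ((x \<otimes>\<^sub>t y) \<otimes>\<^sub>t z) = x \<otimes>\<^sub>t y \<otimes>\<^sub>t z"
proof -
  define A where "A s z = tensor_lift (\<lambda>x y. x \<otimes>\<^sub>t y \<otimes>\<^sub>t z) s" for s :: "'a \<otimes> 'b" and z :: 'c
  have "cbilinear (\<lambda>(x :: 'a) (y :: 'b). x \<otimes>\<^sub>t y \<otimes>\<^sub>t z)" for z :: 'c
    unfolding cbilinear_iff by (simp add: pure_tensor_bilinear)
  from clinear_tensor_lift[OF this] tensor_lift_pure[OF this]
  have A: "clinear (\<lambda>s. A s z)" and A_pure: "A (x \<otimes>\<^sub>t y) z = x \<otimes>\<^sub>t y \<otimes>\<^sub>t z" for x y z
    unfolding A_def by simp_all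
  note lin = A[unfolded clinear_iff, THEN conjunct1, rule_format]
    A[unfolded clinear_iff, THEN conjunct2, rule_format]
  \<comment> \<open>The outer lift in \<open>tensor_assoc\<close> requires linearity in the third
    factor for arbitrary \<open>s\<close>, which is checked on pure \<open>s\<close>.\<close>
  have "A s (z + z') = A s z + A s z'" for s z z'
    by (rule clinear_tensor_ext[OF A])
      (simp_all add: clinear_iff lin scaleC_add_right A_pure pure_tensor_bilinear)
  moreover have "A s (c *\<^sub>C z) = c *\<^sub>C A s z" for s c z
    by (rule clinear_tensor_ext[OF A])
      (simp_all add: clinear_iff lin scaleC_add_right scaleC_scaleC mult.commute A_pure
        pure_tensor_bilinear)
  ultimately have "cbilinear A"
    unfolding cbilinear_iff by (simp add: lin)
  from clinear_tensor_lift[OF this] tensor_lift_pure[OF this, of "x \<otimes>\<^sub>t y" z]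
  show "clinear (tensor_assoc :: ('a \<otimes> 'b) \<otimes> 'c \<Rightarrow> 'a \<otimes> 'b \<otimes> 'c)" "tensor_assoc ((x \<otimes>\<^sub>t y) \<otimes>\<^sub>t z) = x \<otimes>\<^sub>t y \<otimes>\<^sub>t z"
    unfolding tensor_assoc_def A_def[abs_def, symmetric] by (simp_all add: A_pure)
qed

section \<open>Characters and universal R-matrices\<close>

text \<open>Apply id \<otimes> f \<otimes> g to the hexagon identity for id \<otimes> \<Delta>. Leg
  13 meets \<open>g\<close>, leg 12 meets \<open>f\<close>, and the idle leg contributes the value 1
  at the unit; hence the order of the factors is reversed.\<close>

lemma contract_right_convolution:
  fixes f g h :: "'a::complex_algebra_1 \<Rightarrow> complex"
  assumes f: "algebra_hom f" and g: "algebra_hom g" and h: "algebra_hom h" and \<Delta>: "clinear \<Delta>"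
    and conv: "\<And>x. functional_tensor f g (\<Delta> x) = h x"
    and R: "tensor_map id \<Delta> R = leg13 R * leg12 R"
  shows "contract_right h R = contract_right g R * contract_right f R"
proof -
  let ?F = "contract_right (functional_tensor f g) :: 'a \<otimes> 'a \<otimes> 'a \<Rightarrow> 'a"
  note fg = algebra_hom_functional_tensor[OF f g]
  note pure = contract_right_pure[OF algebra_homD(1)[OF fg]] functional_tensor_pure[OF f g]
    contract_right_pure[OF algebra_homD(1)[OF f]] contract_right_pure[OF algebra_homD(1)[OF g]]
    contract_right_pure[OF algebra_homD(1)[OF h]]
  note lin = clinear_contract_right[OF algebra_homD(1)[OF fg], unfolded clinear_iff]
  have F_map: "?F (tensor_map (\<lambda>x. x) \<Delta> t) = contract_right h t" for t
    by (rule clinear_tensor_ext[OF _ clinear_contract_right[OF algebra_homD(1)[OF h]]])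
      (simp_all add: clinear_iff clinear_tensor_map[OF clinear_id \<Delta>, unfolded clinear_iff] lin
        tensor_map_pure[OF clinear_id \<Delta>] pure conv)
  have F13: "?F (leg13 t) = contract_right g t" for t
    by (rule clinear_tensor_ext[OF _ clinear_contract_right[OF algebra_homD(1)[OF g]]])
      (simp_all add: clinear_iff clinear_leg13[unfolded clinear_iff] lin leg13_pure pure
        algebra_homD(2)[OF f])
  have F12: "?F (leg12 t) = contract_right f t" for t
    by (rule clinear_tensor_ext[OF _ clinear_contract_right[OF algebra_homD(1)[OF f]]])
      (simp_all add: clinear_iff clinear_leg12[unfolded clinear_iff] lin leg12_pure pure
        algebra_homD(2)[OF g])
  have "contract_right h R = ?F (leg13 R * leg12 R)"
    by (simp add: F_map flip: R[unfolded id_def])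
  also have "\<dots> = contract_right g R * contract_right f R"
    by (simp add: algebra_homD(3)[OF algebra_hom_contract_right[OF fg]] F13 F12)
  finally show ?thesis .
qed

text \<open>The mirror argument, with f \<otimes> g \<otimes> id applied to the other hexagon
  identity; here the order of \<open>f\<close> and \<open>g\<close> is preserved.\<close>

lemma contract_left_convolution:
  fixes f g h :: "'a::complex_algebra_1 \<Rightarrow> complex"
  assumes f: "algebra_hom f" and g: "algebra_hom g" and h: "algebra_hom h" and \<Delta>: "clinear \<Delta>"
    and conv: "\<And>x. functional_tensor f g (\<Delta> x) = h x"
    and R: "tensor_assoc (tensor_map \<Delta> id R) = leg13 R * leg23 R"
  shows "contract_left h R = contract_left f R * contract_left g R"
proof -
  let ?F = "\<lambda>t :: 'a \<otimes> 'a \<otimes> 'a. contract_left g (contract_left f t)"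
  note pure = contract_left_pure[OF algebra_homD(1)[OF f]] contract_left_pure[OF algebra_homD(1)[OF g]]
    contract_left_pure[OF algebra_homD(1)[OF h]] functional_tensor_pure[OF f g]
  note lin = clinear_contract_left[OF algebra_homD(1)[OF f], unfolded clinear_iff]
    clinear_contract_left[OF algebra_homD(1)[OF g], unfolded clinear_iff]
  note fg = algebra_homD(1)[OF algebra_hom_functional_tensor[OF f g], unfolded clinear_iff]
  have F_assoc: "?F (tensor_assoc (s \<otimes>\<^sub>t y)) = functional_tensor f g s *\<^sub>C y" for s y
    by (rule clinear_tensor_ext[of "\<lambda>s. ?F (tensor_assoc (s \<otimes>\<^sub>t y))"])
      (simp_all add: clinear_iff clinear_tensor_assoc[unfolded clinear_iff] lin fg
        pure_tensor_bilinear tensor_assoc_pure pure scaleC_add_left scaleC_scaleC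
        scaleC_complex_mult)
  have F_map: "?F (tensor_assoc (tensor_map \<Delta> (\<lambda>x. x) t)) = contract_left h t" for t
    by (rule clinear_tensor_ext[OF _ clinear_contract_left[OF algebra_homD(1)[OF h]]])
      (simp_all add: clinear_iff clinear_tensor_map[OF \<Delta> clinear_id, unfolded clinear_iff] lin
        clinear_tensor_assoc[unfolded clinear_iff] tensor_map_pure[OF \<Delta> clinear_id] F_assoc pure conv)
  have F13: "?F (leg13 t) = contract_left f t" for t
    by (rule clinear_tensor_ext[OF _ clinear_contract_left[OF algebra_homD(1)[OF f]]])
      (simp_all add: clinear_iff clinear_leg13[unfolded clinear_iff] lin leg13_pure pure
        algebra_homD(2)[OF g] scaleC_one)
  have F23: "?F (leg23 t) = contract_left g t" for t
    by (rule clinear_tensor_ext[OF _ clinear_contract_left[OF algebra_homD(1)[OF g]]])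
      (simp_all add: clinear_iff clinear_leg23[unfolded clinear_iff] lin leg23_pure pure
        algebra_homD(2)[OF f] scaleC_one)
  have "contract_left h R = ?F (leg13 R * leg23 R)"
    by (simp add: F_map flip: R[unfolded id_def])
  also have "\<dots> = contract_left f R * contract_left g R"
    by (simp add: algebra_homD(3)[OF algebra_hom_contract_left[OF f]]
        algebra_homD(3)[OF algebra_hom_contract_left[OF g]] F13 F23)
  finally show ?thesis .
qed

text \<open>Slicing by a character splits the product of the flipped R and R, and the flip turns the
  right slice of the first factor into a left slice.\<close>

lemma drinfeld_map_character:
  assumes "algebra_hom f"
  shows "drinfeld_map R (Abs_dual f) = contract_left f R * contract_right f R"
proof -
  have f: "clinear f"
    using assms by (rule algebra_homD)
  have "drinfeld_map R (Abs_dual f) = contract_right f (tensor_flip R * R)"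
    using f by (simp add: drinfeld_map_def contract_right_def Abs_dual_inverse)
  then show ?thesis
    by (simp add: algebra_homD(3)[OF algebra_hom_contract_right[OF assms]] contract_right_flip[OF f])
qed

lemma not_vector_space_iso_drinfeld_map:
  assumes "algebra_hom f" "algebra_hom g" "f \<noteq> g"
    and "contract_left f R * contract_right f R = contract_left g R * contract_right g R"
  shows "\<not> vector_space_iso (drinfeld_map R)"
proof
  assume "vector_space_iso (drinfeld_map R)"
  then have "inj (drinfeld_map R)"
    by (simp add: vector_space_iso_def bij_is_inj)
  moreover have "drinfeld_map R (Abs_dual f) = drinfeld_map R (Abs_dual g)"
    using assms(4) by (simp add: drinfeld_map_character[OF assms(1)] drinfeld_map_character[OF assms(2)])
  ultimately have "Abs_dual f = Abs_dual g"
    by (rule injD)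
  then show False
    using assms(3) by (simp add: Abs_dual_inject algebra_homD(1)[OF assms(1)] algebra_homD(1)[OF assms(2)])
qed

section \<open>The sign character of a Nichols Hopf algebra\<close>

locale nichols =
  fixes m :: nat and \<Delta> :: "'a::complex_algebra_1 \<Rightarrow> 'a \<otimes> 'a" and \<epsilon> S K \<xi>
  assumes nichols: "nichols_hopf_algebra m \<Delta> \<epsilon> S K \<xi>"
begin

lemma hopf: "algebra_hom \<Delta>" "algebra_hom \<epsilon>"
  using nichols by (simp_all add: nichols_hopf_algebra_def hopf_algebra_def)

lemma dim_eq: "complex_vector.dim (UNIV :: 'a set) = 2 ^ (m + 1)"
  and generated: "subalgebra hull (insert K (\<xi> ` {1..m})) = UNIV"
  and K_square: "K * K = 1"
  using nichols by (simp_all add: nichols_hopf_algebra_def power2_eq_square)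

lemma relations:
  assumes "i \<in> {1..m}"
  shows "\<xi> i * \<xi> i = 0" "K * \<xi> i = - (\<xi> i * K)"
    "\<Delta> (\<xi> i) = K \<otimes>\<^sub>t \<xi> i + \<xi> i \<otimes>\<^sub>t 1" "\<epsilon> (\<xi> i) = 0"
  using nichols assms by (simp_all add: nichols_hopf_algebra_def power2_eq_square)

lemma xi_anticommute:
  assumes "i \<in> {1..m}" "j \<in> {1..m}"
  shows "\<xi> i * \<xi> j = - (\<xi> j * \<xi> i)"
  using nichols assms unfolding nichols_hopf_algebra_def by blast

lemma K_coproduct: "\<Delta> K = K \<otimes>\<^sub>t K" "\<epsilon> K = 1"
  using nichols by (simp_all add: nichols_hopf_algebra_def)

lemma generator_induct [case_names add scale one mult K xi]:
  assumes "\<And>x y. P x \<Longrightarrow> P y \<Longrightarrow> P (x + y)" "\<And>c x. P x \<Longrightarrow> P (c *\<^sub>C x)" "P 1"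
    "\<And>x y. P x \<Longrightarrow> P y \<Longrightarrow> P (x * y)" "P K" "\<And>i. i \<in> {1..m} \<Longrightarrow> P (\<xi> i)"
  shows "P x"
  using generated by (rule generated_algebra_induct) (use assms in blast)+

text \<open>With \<open>K = 1\<close> the relation between \<open>K\<close> and
  \<open>\<xi> i\<close> reads \<open>\<xi> i = - \<xi> i\<close>, so every \<open>\<xi> i\<close>
  is 0 and the algebra is spanned by 1. This contradicts the prescribed dimension, which is at least
  2.\<close>

lemma K_neq_1: "K \<noteq> 1"
proof
  assume K: "K = 1"
  have "\<xi> i = 0" if "i \<in> {1..m}" for i
  proof -
    have "(2 :: complex) *\<^sub>C \<xi> i = (1 + 1) *\<^sub>C \<xi> i"
      by simp
    also have "\<dots> = \<xi> i + \<xi> i"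
      unfolding scaleC_add_left scaleC_one ..
    also have "\<dots> = 0"
      using relations(2)[OF that] by (simp add: K eq_neg_iff_add_eq_0)
    finally show ?thesis
      by (simp add: complex_vector.scale_eq_0_iff)
  qed
  then have "\<exists>c. x = c *\<^sub>C 1" for x :: 'a
  proof (induction x rule: generator_induct)
    case (add x y)
    then show ?case by (metis scaleC_add_left)
  next
    case (scale c x)
    then show ?case by (metis scaleC_scaleC)
  next
    case one
    show ?case by (metis scaleC_one)
  next
    case (mult x y)
    then show ?case by (metis mult_1 mult_scaleC_left scaleC_scaleC)
  next
    case K
    show ?case by (metis \<open>K = 1\<close> scaleC_one)
  next
    case (xi i)
    then show ?case by (intro exI[of _ 0]) (simp add: complex_vector.scale_zero_left)
  qed
  then have "UNIV \<subseteq> complex_vector.span {1 :: 'a}"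
    by (metis complex_vector.span_base complex_vector.span_scale insertI1 subsetI)
  then have "complex_vector.dim (UNIV :: 'a set) \<le> card {1 :: 'a}"
    by (intro complex_vector.dim_le_card) auto
  moreover have "(1 :: nat) \<le> 2 ^ m"
    by simp
  ultimately show False
    by (simp add: dim_eq)
qed

section \<open>The nilpotent ideal and the character obtained from it\<close>

definition nil_ideal :: "'a set"
  where "nil_ideal = range (\<lambda>h. \<Sum>i\<in>{1..m}. h i * \<xi> i)"

text \<open>\<open>\<xi> i\<close> anticommutes with every generator, and the elements it can be
  moved past form a subalgebra. Hence the left combinations in \<open>nil_ideal\<close> also absorb
  multiplication from the right.\<close>

lemma xi_normal:
  assumes i: "i \<in> {1..m}"
  shows "\<exists>y. \<xi> i * x = y * \<xi> i"
proof (induction x rule: generator_induct)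
  case (add x y)
  then show ?case by (metis distrib_left distrib_right)
next
  case (scale c x)
  then show ?case by (metis mult_scaleC_left mult_scaleC_right)
next
  case one
  show ?case by (rule exI[of _ 1]) simp
next
  case (mult x y)
  then show ?case by (metis mult.assoc)
next
  case K
  have "\<xi> i * K = - K * \<xi> i"
    by (simp add: relations(2)[OF i])
  then show ?case ..
next
  case (xi j)
  then have "\<xi> i * \<xi> j = - \<xi> j * \<xi> i"
    by (simp add: xi_anticommute[OF i])
  then show ?case ..
qed

lemma nil_ideal_nilpotent: "x \<in> nil_ideal \<Longrightarrow> \<exists>N. x ^ N = 0"
  unfolding nil_ideal_def
  using sum_normal_square_zero_nilpotent[of "{1..m}" \<xi>] relations(1) xi_normal by auto

lemma nil_ideal_idempotent:
  assumes "x \<in> nil_ideal" "x * x = x"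
  shows "x = 0"
proof -
  have "x ^ Suc N = x" for N
    by (induction N) (simp_all add: assms(2))
  moreover obtain N where "x ^ N = 0"
    using nil_ideal_nilpotent[OF assms(1)] by blast
  ultimately show ?thesis
    by (metis mult_zero_right power_Suc)
qed

lemma nil_ideal_add: "x \<in> nil_ideal \<Longrightarrow> y \<in> nil_ideal \<Longrightarrow> x + y \<in> nil_ideal"
  unfolding nil_ideal_def
proof clarify
  fix h h'
  have "(\<Sum>i\<in>{1..m}. h i * \<xi> i) + (\<Sum>i\<in>{1..m}. h' i * \<xi> i) = (\<Sum>i\<in>{1..m}. (h i + h' i) * \<xi> i)"
    by (simp add: sum.distrib distrib_right)
  then show "(\<Sum>i\<in>{1..m}. h i * \<xi> i) + (\<Sum>i\<in>{1..m}. h' i * \<xi> i)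
      \<in> range (\<lambda>h. \<Sum>i\<in>{1..m}. h i * \<xi> i)"
    by (intro image_eqI[where x = "\<lambda>i. h i + h' i"]) auto
qed

lemma nil_ideal_mult_left: "x \<in> nil_ideal \<Longrightarrow> y * x \<in> nil_ideal"
  unfolding nil_ideal_def
proof clarify
  fix h
  show "y * (\<Sum>i\<in>{1..m}. h i * \<xi> i) \<in> range (\<lambda>h. \<Sum>i\<in>{1..m}. h i * \<xi> i)"
    by (rule image_eqI[where x = "\<lambda>i. y * h i"]) (simp_all add: sum_distrib_left mult.assoc)
qed

lemma nil_ideal_mult_right: "x \<in> nil_ideal \<Longrightarrow> x * y \<in> nil_ideal"
  unfolding nil_ideal_def
proof clarify
  fix h
  have "\<forall>i\<in>{1..m}. \<exists>w. \<xi> i * y = w * \<xi> i"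
    using xi_normal by blast
  then obtain w where w: "\<forall>i\<in>{1..m}. \<xi> i * y = w i * \<xi> i"
    by (rule bchoice[THEN exE])
  show "(\<Sum>i\<in>{1..m}. h i * \<xi> i) * y \<in> range (\<lambda>h. \<Sum>i\<in>{1..m}. h i * \<xi> i)"
  proof (rule image_eqI[where x = "\<lambda>i. h i * w i"])
    show "(\<Sum>i\<in>{1..m}. h i * \<xi> i) * y = (\<Sum>i\<in>{1..m}. h i * w i * \<xi> i)"
      unfolding sum_distrib_right by (rule sum.cong) (simp_all add: mult.assoc w)
  qed simp
qed

lemma zero_in_nil_ideal: "0 \<in> nil_ideal"
  unfolding nil_ideal_def by (rule image_eqI[where x = "\<lambda>_. 0"]) simp_all

lemma nil_ideal_scale: "x \<in> nil_ideal \<Longrightarrow> c *\<^sub>C x \<in> nil_ideal"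
  using nil_ideal_mult_left[of x "c *\<^sub>C 1"] by (simp add: mult_scaleC_left)

lemma xi_in_nil_ideal:
  assumes "i \<in> {1..m}"
  shows "\<xi> i \<in> nil_ideal"
  unfolding nil_ideal_def
  by (rule image_eqI[where x = "\<lambda>j. if j = i then 1 else 0"])
    (use assms in \<open>simp_all add: if_distrib[of "\<lambda>a. a * _"] cong: if_cong\<close>)

lemma subspace_nil_ideal: "complex_vector.subspace nil_ideal"
  by (simp add: complex_vector.subspace_def zero_in_nil_ideal nil_ideal_add nil_ideal_scale)

text \<open>Half of \<open>1 - g\<close> is an idempotent in the ideal, hence 0. This serves twice:
  for \<open>K\<close>, to place \<open>1 - K\<close> outside the ideal, and for the product of the
  two slices of R.\<close>

lemma involution_eq_1:
  assumes "1 - g \<in> nil_ideal" "g * g = 1"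
  shows "g = 1"
proof -
  have scale2: "(2 :: complex) *\<^sub>C x = x + x" for x :: 'a
    unfolding one_add_one[symmetric] scaleC_add_left scaleC_one ..
  have "(1 - g) * (1 - g) = 2 *\<^sub>C (1 - g)"
    by (simp add: scale2 algebra_simps assms(2))
  then have "((1 / 2) *\<^sub>C (1 - g)) * ((1 / 2) *\<^sub>C (1 - g)) = (1 / 2) *\<^sub>C (1 - g)"
    by (simp add: mult_scaleC_left mult_scaleC_right scaleC_scaleC)
  then have "(1 / 2) *\<^sub>C (1 - g) = 0"
    using nil_ideal_scale[OF assms(1)] by (intro nil_ideal_idempotent)
  then show ?thesis
    by (simp add: complex_vector.scale_eq_0_iff)
qed

text \<open>No quotient algebra is formed: a functional vanishing on the ideal is composed with left
  multiplication by \<open>1 - K\<close>. Multiplicativity then follows from the behaviour under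
  left multiplication by each generator.\<close>

lemma sign_character_exists:
  "\<exists>\<chi> :: 'a \<Rightarrow> complex. algebra_hom \<chi> \<and> \<chi> K = -1 \<and> (\<forall>i\<in>{1..m}. \<chi> (\<xi> i) = 0)"
proof -
  have "1 - K \<notin> nil_ideal"
    using involution_eq_1 K_square K_neq_1 by blast
  then obtain \<phi> :: "'a \<Rightarrow> complex"
    where \<phi>: "clinear \<phi>" and J: "\<And>x. x \<in> nil_ideal \<Longrightarrow> \<phi> x = 0" and one: "\<phi> (1 - K) = 1"
    using separating_functional[OF subspace_nil_ideal] by metis
  note lin = \<phi>[unfolded clinear_iff, THEN conjunct1, rule_format]
    \<phi>[unfolded clinear_iff, THEN conjunct2, rule_format]
  \<comment> \<open>The sign at \<open>K\<close> comes from \<open>(1 - K) K = - (1 - K)\<close>.\<close>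
  define \<chi> where "\<chi> x = \<phi> ((1 - K) * x)" for x
  have neg: "\<phi> (- x) = - \<phi> x" for x
    using complex_vector.linear_neg[OF \<phi>] .
  have \<chi>_K: "\<chi> (K * x) = - \<chi> x" for x
  proof -
    have "(1 - K) * (K * x) = - ((1 - K) * x)"
      by (simp add: algebra_simps K_square flip: mult.assoc)
    then show ?thesis
      by (simp add: \<chi>_def neg)
  qed
  have \<xi>: "\<chi> (\<xi> i * x) = 0" if "i \<in> {1..m}" for i x
    unfolding \<chi>_def using that
    by (intro J nil_ideal_mult_left nil_ideal_mult_right xi_in_nil_ideal)
  have \<chi>1: "\<chi> 1 = 1"
    by (simp add: \<chi>_def one)
  have \<chi>: "\<chi> (x + y) = \<chi> x + \<chi> y" "\<chi> (c *\<^sub>C x) = c * \<chi> x" for x y c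
    by (simp_all add: \<chi>_def distrib_left lin mult_scaleC_right scaleC_complex_mult)
  \<comment> \<open>The right factor is quantified because the product case uses the hypothesis for
    \<open>x\<close> with right factor \<open>y * z\<close>.\<close>
  have "\<forall>y. \<chi> (x * y) = \<chi> x * \<chi> y" for x
  proof (induction x rule: generator_induct)
    case K
    show ?case
      using \<chi>_K[of 1] by (simp add: \<chi>_K \<chi>1)
  next
    case (xi i)
    then show ?case
      using \<xi>[of i 1] by (simp add: \<xi>)
  qed (simp_all add: \<chi> \<chi>1 distrib_right mult_scaleC_left mult.assoc)
  then have "algebra_hom \<chi>"
    by (simp add: algebra_hom_def clinear_iff \<chi> \<chi>1 scaleC_complex_mult)
  moreover have "\<chi> K = -1" "\<forall>i\<in>{1..m}. \<chi> (\<xi> i) = 0"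
    using \<chi>_K[of 1] \<xi>[of _ 1] by (simp_all add: \<chi>1)
  ultimately show ?thesis
    by blast
qed

definition sign_character :: "'a \<Rightarrow> complex"
  where "sign_character = (SOME \<chi>. algebra_hom \<chi> \<and> \<chi> K = -1 \<and> (\<forall>i\<in>{1..m}. \<chi> (\<xi> i) = 0))"

lemma sign_character:
  shows algebra_hom_sign_character: "algebra_hom sign_character"
    and sign_character_K: "sign_character K = -1"
    and sign_character_xi: "i \<in> {1..m} \<Longrightarrow> sign_character (\<xi> i) = 0"
  using someI_ex[OF sign_character_exists] unfolding sign_character_def by blast+

lemma sign_character_neq_counit: "sign_character \<noteq> \<epsilon>"
  using sign_character_K K_coproduct(2) by force

text \<open>Modulo the ideal every element is a combination of 1 and \<open>K\<close>, and the
  values of the two characters determine both coefficients.\<close>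

lemma in_nil_idealI:
  assumes "sign_character x = 0" "\<epsilon> x = 0"
  shows "x \<in> nil_ideal"
proof -
  note chi = algebra_homD[OF algebra_hom_sign_character] and eps = algebra_homD[OF hopf(2)]
  \<comment> \<open>The map \<open>s\<close> is the projection onto \<open>span {1, K}\<close> along \<open>nil_ideal\<close>.\<close>
  define s where "s x = ((\<epsilon> x + sign_character x) / 2) *\<^sub>C 1
      + ((\<epsilon> x - sign_character x) / 2) *\<^sub>C K" for x
  have s_add: "s (x + y) = s x + s y" for x y
    by (simp add: s_def chi eps add_divide_distrib diff_divide_distrib scaleC_add_left
        complex_vector.scale_left_diff_distrib algebra_simps)
  have s_scale: "s (c *\<^sub>C x) = c *\<^sub>C s x" for c x
    by (simp add: s_def chi(5) eps(5) scaleC_complex_mult scaleC_add_right scaleC_scaleC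
        algebra_simps)
  have s_mult: "s (x * y) = s x * s y" for x y
  proof -
    have mult: "(a *\<^sub>C 1 + b *\<^sub>C K) * (c *\<^sub>C 1 + d *\<^sub>C K)
        = (a * c + b * d) *\<^sub>C 1 + (a * d + b * c) *\<^sub>C K" for a b c d
      by (simp add: mult_scaleC_left mult_scaleC_right scaleC_scaleC distrib_left distrib_right
          scaleC_add_left scaleC_add_right K_square algebra_simps)
    \<comment> \<open>The Fourier transform of the group of order 2: the product on the span of 1
      and \<open>K\<close> becomes pointwise multiplication of character values.\<close>
    have halves: "(p + q) / 2 * ((p' + q') / 2) + (p - q) / 2 * ((p' - q') / 2) = (p * p' + q * q') / 2"
      "(p + q) / 2 * ((p' - q') / 2) + (p - q) / 2 * ((p' + q') / 2) = (p * p' - q * q') / 2"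
      for p q p' q' :: complex
      by (simp_all add: field_simps)
    show ?thesis
      unfolding s_def chi(3) eps(3) mult halves by (rule refl)
  qed
  have "x - s x \<in> nil_ideal" for x
  proof (induction x rule: generator_induct)
    case (add x y)
    have "x + y - s (x + y) = (x - s x) + (y - s y)"
      by (simp add: s_add)
    then show ?case
      using nil_ideal_add[OF add] by (simp only:)
  next
    case (scale c x)
    have "c *\<^sub>C x - s (c *\<^sub>C x) = c *\<^sub>C (x - s x)"
      by (simp add: s_scale complex_vector.scale_right_diff_distrib)
    then show ?case
      using nil_ideal_scale[OF scale] by (simp only:)
  next
    case one
    show ?case
      by (simp add: s_def chi eps scaleC_one complex_vector.scale_zero_left zero_in_nil_ideal)
  next
    case (mult x y)
    have "x * y - s (x * y) = (x - s x) * y + s x * (y - s y)"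
      by (simp add: s_mult algebra_simps)
    then show ?case
      using nil_ideal_add[OF nil_ideal_mult_right[OF mult(1)] nil_ideal_mult_left[OF mult(2)]]
      by (simp only:)
  next
    case K
    show ?case
      by (simp add: s_def sign_character_K K_coproduct scaleC_one complex_vector.scale_zero_left
          zero_in_nil_ideal)
  next
    case (xi i)
    then show ?case
      by (simp add: s_def sign_character_xi relations(4) complex_vector.scale_zero_left
          xi_in_nil_ideal)
  qed
  from this[of x] show ?thesis
    by (simp add: s_def assms complex_vector.scale_zero_left)
qed

section \<open>Slices of an arbitrary universal R-matrix\<close>

lemma functional_tensor_coproduct:
  assumes f: "algebra_hom f" and \<xi>: "\<And>i. i \<in> {1..m} \<Longrightarrow> f (\<xi> i) = 0" and K: "f K * f K = 1"
  shows "functional_tensor f f (\<Delta> x) = \<epsilon> x"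
proof -
  note ff = algebra_hom_functional_tensor[OF f f]
  show ?thesis
  \<comment> \<open>Both sides are characters, so generators suffice: each term of the coproduct of
    \<open>\<xi> i\<close> has a factor \<open>\<xi> i\<close>, which \<open>f\<close>
    kills.\<close>
  proof (rule algebra_hom_eqI[OF generated algebra_hom_compose[OF ff hopf(1)] hopf(2)])
    fix x
    assume "x \<in> insert K (\<xi> ` {1..m})"
    then show "functional_tensor f f (\<Delta> x) = \<epsilon> x"
      by (auto simp: K_coproduct relations(3,4) algebra_homD(4)[OF ff] functional_tensor_pure[OF f f]
          K \<xi>)
  qed
qed

text \<open>The counit is its own convolution square, so both slices are idempotent; they are
  invertible because R is, and an invertible idempotent is 1.\<close>

lemma contract_counit_eq_1:
  assumes "universal_R_matrix \<Delta> R"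
  shows "contract_right \<epsilon> R = 1" "contract_left \<epsilon> R = 1"
proof -
  obtain R' where R': "R * R' = 1"
    using assms unfolding universal_R_matrix_def by blast
  have eps: "functional_tensor \<epsilon> \<epsilon> (\<Delta> x) = \<epsilon> x" for x
    by (rule functional_tensor_coproduct[OF hopf(2)]) (simp_all add: relations(4) K_coproduct(2))
  have one: "f R = 1" if "algebra_hom f" "f R = f R * f R" for f :: "'a \<otimes> 'a \<Rightarrow> 'a"
  proof -
    have "f R * f R' = 1"
      using R' algebra_homD(2,3)[OF that(1)] by metis
    then show ?thesis
      using that(2) by (metis mult.assoc mult_1_right)
  qed
  show "contract_right \<epsilon> R = 1"
    using assms
    by (intro one algebra_hom_contract_right hopf contract_right_convolution[OF _ _ _ _ eps])
      (simp_all add: hopf algebra_homD(1) universal_R_matrix_def)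
  show "contract_left \<epsilon> R = 1"
    using assms
    by (intro one algebra_hom_contract_left hopf contract_left_convolution[OF _ _ _ _ eps])
      (simp_all add: hopf algebra_homD(1) universal_R_matrix_def)
qed

text \<open>R carries the coproduct to its opposite and the flipped R carries it back, so their
  product commutes with every \<open>\<Delta> x\<close>. Slicing by the character gives commutation
  with the slices of \<open>\<Delta> x\<close>.\<close>

lemma central_contraction:
  assumes "universal_R_matrix \<Delta> R"
  shows "contract_right sign_character (tensor_flip R * R) * x
    = x * contract_right sign_character (tensor_flip R * R)"
proof -
  let ?Q = "tensor_flip R * R" and ?T = "contract_right sign_character :: 'a \<otimes> 'a \<Rightarrow> 'a"
  have T: "algebra_hom ?T"
    by (rule algebra_hom_contract_right[OF algebra_hom_sign_character])
  note pure = contract_right_pure[OF algebra_homD(1)[OF algebra_hom_sign_character]]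
  obtain R' where R': "R' * R = 1" "\<And>x. tensor_flip (\<Delta> x) = R * \<Delta> x * R'"
    using assms unfolding universal_R_matrix_def by blast
  have R: "tensor_flip (\<Delta> x) * R = R * \<Delta> x" for x
    by (simp add: R' mult.assoc)
  have flip_R: "\<Delta> x * tensor_flip R = tensor_flip R * tensor_flip (\<Delta> x)" for x
    using arg_cong[OF R[of x], of tensor_flip]
    by (simp add: algebra_homD(3)[OF algebra_hom_tensor_flip] tensor_flip_flip)
  define g where "g = ?T ?Q"
  have "?Q * \<Delta> x = \<Delta> x * ?Q" for x
    by (metis R flip_R mult.assoc)
  from this[THEN arg_cong, of ?T] have comm: "g * ?T (\<Delta> x) = ?T (\<Delta> x) * g" for x
    by (simp only: g_def algebra_homD(3)[OF T])
  \<comment> \<open>The slices of the generators' coproducts are \<open>- K\<close> and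
    \<open>\<xi> i\<close>, which still generate the whole algebra.\<close>
  have T_K: "?T (\<Delta> K) = - K"
    by (simp add: K_coproduct pure sign_character_K complex_vector.scale_minus_left scaleC_one)
  have \<xi>: "?T (\<Delta> (\<xi> i)) = \<xi> i" if "i \<in> {1..m}" for i
    using that
    by (simp add: relations(3) algebra_homD(4)[OF T] pure sign_character_xi scaleC_one
        algebra_homD(2)[OF algebra_hom_sign_character] complex_vector.scale_zero_left)
  have "g * x = x * g"
  proof (induction x rule: generator_induct)
    case (mult x y)
    then show ?case by (metis mult.assoc)
  next
    case K
    show ?case using comm[of K] by (simp add: T_K)
  next
    case (xi i)
    then show ?case using comm[of "\<xi> i"] by (simp add: \<xi>)
  qed (simp_all add: distrib_left distrib_right mult_scaleC_left mult_scaleC_right)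
  then show ?thesis
    by (simp only: g_def)
qed

text \<open>The Drinfeld image of the sign character is therefore 1, as is that of the
  counit.\<close>

lemma contract_sign_character_eq_1:
  assumes R: "universal_R_matrix \<Delta> R"
  shows "contract_left sign_character R * contract_right sign_character R = 1"
proof -
  let ?\<chi> = sign_character
  note \<chi> = algebra_hom_sign_character
  define a where "a = contract_right ?\<chi> R"
  define b where "b = contract_left ?\<chi> R"
  have conv: "functional_tensor ?\<chi> ?\<chi> (\<Delta> x) = \<epsilon> x" for x
    by (rule functional_tensor_coproduct[OF \<chi>]) (simp_all add: sign_character_xi sign_character_K)
  have aa: "a * a = 1"
    using contract_right_convolution[OF \<chi> \<chi> hopf(2) algebra_homD(1)[OF hopf(1)] conv, of R] R
    by (simp add: a_def universal_R_matrix_def contract_counit_eq_1)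
  have bb: "b * b = 1"
    using contract_left_convolution[OF \<chi> \<chi> hopf(2) algebra_homD(1)[OF hopf(1)] conv, of R] R
    by (simp add: b_def universal_R_matrix_def contract_counit_eq_1)
  have "contract_right ?\<chi> (tensor_flip R * R) = b * a"
    by (simp add: a_def b_def algebra_homD(3)[OF algebra_hom_contract_right[OF \<chi>]]
        contract_right_flip[OF algebra_homD(1)[OF \<chi>]])
  \<comment> \<open>Centrality is tested against \<open>b\<close>; cancelling the involution
    \<open>b\<close> on the left makes \<open>a\<close> and \<open>b\<close> commute.\<close>
  then have "b * a * b = b * (b * a)"
    using central_contraction[OF R, of b] by simp
  then have "a * b = b * a"
    by (metis bb mult.assoc mult_1_left)
  then have square: "b * a * (b * a) = 1"
    by (metis aa bb mult.assoc mult_1_right)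
  have "?\<chi> a * ?\<chi> a = 1"
    using arg_cong[OF aa, of ?\<chi>] by (simp add: algebra_homD(2,3)[OF \<chi>])
  \<comment> \<open>Both are the value of \<chi> \<otimes> \<chi> at R.\<close>
  moreover have "?\<chi> b = ?\<chi> a"
    unfolding a_def b_def using \<chi> \<chi>[THEN algebra_homD(1)] by (simp add: contract_swap)
  ultimately have "?\<chi> (b * a) = 1"
    by (simp add: algebra_homD(3)[OF \<chi>])
  \<comment> \<open>Exchanging the slices gives the value of the character at the counit slice of R,
    which is 1.\<close>
  moreover have "\<epsilon> a = 1"
    unfolding a_def
    by (simp add: contract_swap algebra_homD(1) hopf \<chi> contract_counit_eq_1[OF R] algebra_homD(2)[OF \<chi>])
  moreover have "\<epsilon> b = 1"
    unfolding b_def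
    by (simp add: algebra_homD(1) hopf \<chi> contract_counit_eq_1[OF R] algebra_homD(2)[OF \<chi>]
        flip: contract_swap)
  ultimately have "1 - b * a \<in> nil_ideal"
    by (intro in_nil_idealI)
      (simp_all add: complex_vector.linear_diff algebra_homD(1,2,3)[OF hopf(2)] algebra_homD(1,2)[OF \<chi>])
  then show ?thesis
    using involution_eq_1 square by (simp add: a_def b_def)
qed

lemma not_factorizable: "\<not> factorizable \<Delta> \<epsilon> S"
proof
  assume "factorizable \<Delta> \<epsilon> S"
  then obtain R where R: "universal_R_matrix \<Delta> R" and iso: "vector_space_iso (drinfeld_map R)"
    by (auto simp: factorizable_def quasitriangular_hopf_algebra_def)
  have "\<not> vector_space_iso (drinfeld_map R)"
    using sign_character_neq_counit
    by (intro not_vector_space_iso_drinfeld_map[OF algebra_hom_sign_character hopf(2)])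
      (simp_all add: contract_sign_character_eq_1[OF R] contract_counit_eq_1[OF R])
  then show False
    using iso by contradiction
qed

end

section \<open>The R-matrix of \<open>K\<^sub>2\<^sub>n\<close>\<close>

lemma algebra_hom_xi_word_eq_0:
  assumes f: "algebra_hom (f :: 'a::complex_algebra_1 \<Rightarrow> complex)"
    and "finite I" "i \<in> I" "f (\<xi> i) = 0"
  shows "f (xi_word \<xi> I) = 0"
proof -
  have "f (prod_list xs) = 0" if "0 \<in> f ` set xs" for xs
    using that by (induction xs) (auto simp: algebra_homD(3)[OF f])
  moreover have "0 \<in> f ` set (map \<xi> (sorted_list_of_set I))"
    using assms by (force simp: image_iff)
  ultimately show ?thesis
    unfolding xi_word_def by blast
qed

text \<open>Every nonempty word contributes a factor \<open>\<xi> i\<close> to the first leg and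
  \<open>\<xi> (i + n)\<close> to the second, so a character killing all of them leaves only the
  empty word. What remains is the slice of the factor built from \<open>K\<close>.\<close>

lemma
  assumes f: "algebra_hom f" and \<xi>: "\<And>i. i \<in> {1..2 * n} \<Longrightarrow> f (\<xi> i) = 0"
  shows contract_right_nichols_R:
      "contract_right f (nichols_R n K \<xi>) = (1 / 2) *\<^sub>C (1 + K + f K *\<^sub>C 1 - f K *\<^sub>C K)"
    and contract_left_nichols_R:
      "contract_left f (nichols_R n K \<xi>) = (1 / 2) *\<^sub>C (1 + f K *\<^sub>C 1 + K - f K *\<^sub>C K)"
proof -
  define u where "u I = (-1) ^ (card I div 2) *\<^sub>C
      (xi_word \<xi> I \<otimes>\<^sub>t (xi_word (\<lambda>i. \<xi> (i + n)) I * K ^ card I))" for I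
  note fR = algebra_hom_contract_right[OF f] and fL = algebra_hom_contract_left[OF f]
  note lin = f[THEN algebra_homD(1)] fL[THEN algebra_homD(1)] fR[THEN algebra_homD(1)]
  note pure = contract_right_pure[OF lin(1)] contract_left_pure[OF lin(1)]
  have empty: "u {} = 1 \<otimes>\<^sub>t 1"
    by (simp add: u_def xi_word_def scaleC_one)
  have "f (xi_word \<xi> I) = 0 \<and> f (xi_word (\<lambda>i. \<xi> (i + n)) I) = 0"
    if I: "I \<in> Pow {1..n} - {{}}" for I
  proof -
    obtain i where i: "i \<in> I"
      using I by blast
    have "finite I" "i \<in> {1..n}"
      using I i finite_subset[of I "{1..n}"] by auto
    then show ?thesis
      using algebra_hom_xi_word_eq_0[OF f _ i] \<xi> by simp
  qed
  then have "contract_right f (u I) = 0 \<and> contract_left f (u I) = 0"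
    if "I \<in> Pow {1..n} - {{}}" for I
    using that
    by (simp add: u_def fR[THEN algebra_homD(5)] fL[THEN algebra_homD(5)] pure
        algebra_homD(3)[OF f] complex_vector.scale_zero_left complex_vector.scale_zero_right)
  then have sums: "(\<Sum>I\<in>Pow {1..n}. contract_right f (u I)) = 1"
    "(\<Sum>I\<in>Pow {1..n}. contract_left f (u I)) = 1"
    by (subst sum.remove[of _ "{}"];
        simp add: empty pure algebra_homD(2)[OF f] scaleC_one)+
  have R: "nichols_R n K \<xi> = (\<Sum>I\<in>Pow {1..n}. u I)
      * ((1 / 2) *\<^sub>C (1 \<otimes>\<^sub>t 1 + K \<otimes>\<^sub>t 1 + 1 \<otimes>\<^sub>t K - K \<otimes>\<^sub>t K))"
    by (simp add: nichols_R_def u_def)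
  show "contract_right f (nichols_R n K \<xi>) = (1 / 2) *\<^sub>C (1 + K + f K *\<^sub>C 1 - f K *\<^sub>C K)"
    unfolding R using sums
    by (simp add: algebra_homD(3-5)[OF fR] complex_vector.linear_sum[OF lin(3)]
        complex_vector.linear_diff[OF lin(3)] pure algebra_homD(2)[OF f] scaleC_one)
  show "contract_left f (nichols_R n K \<xi>) = (1 / 2) *\<^sub>C (1 + f K *\<^sub>C 1 + K - f K *\<^sub>C K)"
    unfolding R using sums
    by (simp add: algebra_homD(3-5)[OF fL] complex_vector.linear_sum[OF lin(2)]
        complex_vector.linear_diff[OF lin(2)] pure algebra_homD(2)[OF f] scaleC_one)
qed

text \<open>In the explicit slices, the value 1 at \<open>K\<close> gives 1 and the value -1 gives
  \<open>K\<close>. Since \<open>K * K = 1\<close>, both characters have image 1.\<close>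

lemma (in nichols) not_vector_space_iso_nichols_R:
  assumes m: "m = 2 * n"
  shows "\<not> vector_space_iso (drinfeld_map (nichols_R n K \<xi>))"
proof -
  let ?R = "nichols_R n K \<xi>"
  note \<chi> = algebra_hom_sign_character
  have \<xi>: "\<epsilon> (\<xi> i) = 0" "sign_character (\<xi> i) = 0" if "i \<in> {1..2 * n}" for i
    using relations(4) sign_character_xi that m by auto
  have half: "(1 / 2) *\<^sub>C (x + x) = x" for x :: 'a
    unfolding scaleC_add_right scaleC_add_left[symmetric] by (simp add: scaleC_one)
  \<comment> \<open>The coefficients stay unsimplified to match the slice formulas after the value
    at \<open>K\<close> is substituted.\<close>
  have eqs: "1 + 1 *\<^sub>C 1 + K - 1 *\<^sub>C K = 1 + 1" "1 + K + 1 *\<^sub>C 1 - 1 *\<^sub>C K = 1 + 1"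
    "1 + (-1) *\<^sub>C 1 + K - (-1) *\<^sub>C K = K + K" "1 + K + (-1) *\<^sub>C 1 - (-1) *\<^sub>C K = K + K"
    by (simp_all add: scaleC_one complex_vector.scale_minus_left)
  have "contract_left \<epsilon> ?R = 1" "contract_right \<epsilon> ?R = 1"
    by (subst contract_left_nichols_R contract_right_nichols_R;
        simp only: hopf(2) \<xi> K_coproduct(2) eqs half)+
  moreover have "contract_left sign_character ?R = K" "contract_right sign_character ?R = K"
    by (subst contract_left_nichols_R contract_right_nichols_R;
        simp only: \<chi> \<xi> sign_character_K eqs half)+
  ultimately show ?thesis
    using sign_character_neq_counit
    by (intro not_vector_space_iso_drinfeld_map[OF \<chi> hopf(2)]) (simp_all add: K_square)
qed

theorem lemma7p1p9:
  shows "(\<forall>n (\<Delta> :: 'a::complex_algebra_1 \<Rightarrow> 'a \<otimes> 'a) \<epsilon> S K \<xi>.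
            n \<ge> 1 \<longrightarrow> nichols_hopf_algebra (2 * n) \<Delta> \<epsilon> S K \<xi> \<longrightarrow>
            \<not> vector_space_iso (drinfeld_map (nichols_R n K \<xi>)))
       \<and> (\<forall>m (\<Delta> :: 'b::complex_algebra_1 \<Rightarrow> 'b \<otimes> 'b) \<epsilon> S K \<xi>.
            m \<ge> 1 \<longrightarrow> nichols_hopf_algebra m \<Delta> \<epsilon> S K \<xi> \<longrightarrow>
            \<not> factorizable \<Delta> \<epsilon> S)"
  using nichols.not_vector_space_iso_nichols_R nichols.not_factorizable
  unfolding nichols_def by blast

end
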